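(* Let $\mathfrak{A}=\bigoplus_{\lambda\in\Lambda}\mathcal{K}(\mathcal{H}_\lambda)$ be a compact $C^*$-algebra and let $\Phi\colon\mathfrak{A}\to\mathfrak{A}$ be a linear strong BJ isomorphism. Then there exists a scalar $\alpha\neq0$ such that $\frac{1}{\alpha}\Phi=\Phi_1\circ\Phi_2$, where (i) $\Phi_1$ is a permutation of blocks which respects their dimensions; (ii) $\Phi_2$ is a map $X\mapsto UXV^*$ for some unitaries $U=\bigoplus_\lambda U_\lambda$ and $V=\bigoplus_\lambda V_\lambda$ with $U_\lambda,V_\lambda\in\mathcal{B}(\mathcal{H}_\lambda)$.
   Context: $\bigoplus_{\lambda\in\Lambda}\mathcal{K}(\mathcal{H}_\lambda)$ is the $c_0$-direct sum of the algebras of compact operators on nonzero complex Hilbert spaces $\mathcal{H}_\lambda$, acting block-diagonally on $\bigoplus_\lambda\mathcal{H}_\lambda$; $\mathcal{B}(\mathcal{H}_\lambda)$ is the algebra of bounded operators. For elements $x,y$ of a $C^*$-algebra $\mathfrak{A}$, $x\perp_{BJ}^s y$ means $\|x+yz\|\ge\|x\|$ for each $z\in\mathfrak{A}$; a strong BJ isomorphism is a bijection $\Phi$ with $x\perp_{BJ}^s y\iff\Phi(x)\perp_{BJ}^s\Phi(y)$. A permutation of blocks respecting dimensions is a map $(A_\lambda)_\lambda\mapsto(A_{\varphi(\lambda)})_\lambda$, where $\varphi$ is a permutation of $\Lambda$ with $\dim\mathcal{H}_{\varphi(\lambda)}=\dim\mathcal{H}_\lambda$ for all $\lambda$, and $\mathcal{K}(\mathcal{H}_{\varphi(\lambda)})$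 is identified with $\mathcal{K}(\mathcal{H}_\lambda)$ through conjugation by a fixed unitary $\mathcal{H}_{\varphi(\lambda)}\to\mathcal{H}_\lambda$. *)

theory Defs
  imports "HOL-Analysis.Analysis"
begin

subsection \<open>Complex Hilbert spaces\<close>

class scaleC =
  fixes scaleC :: "complex \<Rightarrow> 'a \<Rightarrow> 'a" (infixr \<open>*\<^sub>C\<close> 75)

class complex_vector = real_vector + scaleC +
  assumes scaleC_add_right: "c *\<^sub>C (x + y) = c *\<^sub>C x + c *\<^sub>C y"
    and scaleC_add_left: "(c + d) *\<^sub>C x = c *\<^sub>C x + d *\<^sub>C x"
    and scaleC_scaleC: "c *\<^sub>C d *\<^sub>C x = (c * d) *\<^sub>C x"
    and scaleC_one: "1 *\<^sub>C x = x"
    and scaleR_scaleC: "r *\<^sub>R x = complex_of_real r *\<^sub>C x"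

global_interpretation complex_vector: vector_space "scaleC :: complex \<Rightarrow> 'a \<Rightarrow> 'a::complex_vector"
  defines csubspace = complex_vector.subspace
    and cspan = complex_vector.span
  by unfold_locales (simp_all add: scaleC_add_right scaleC_add_left scaleC_scaleC scaleC_one)

text \<open>The complex inner product is linear in its first argument. Its real part is the real inner
  product, so that positive definiteness and \<open>(norm x)\<^sup>2 = cinner x x\<close> come from the class
  \<open>real_inner\<close>.\<close>

class complex_inner = complex_vector + real_inner +
  fixes cinner :: "'a \<Rightarrow> 'a \<Rightarrow> complex"
  assumes cinner_commute: "cinner x y = cnj (cinner y x)"
    and cinner_add_left: "cinner (x + y) z = cinner x z + cinner y z"
    and cinner_scaleC_left: "cinner (c *\<^sub>C x) y = c * cinner x y"
    and inner_eq_Re_cinner: "inner x y = Re (cinner x y)"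

class chilbert_space = complex_inner + complete_space

lemma cinner_self: "cinner x x = complex_of_real ((norm x)\<^sup>2)"
proof -
  have "Im (cinner x x) = 0"
    using arg_cong[OF cinner_commute[of x x], of Im] by simp
  then show ?thesis
    by (simp add: complex_eq_iff power2_norm_eq_inner inner_eq_Re_cinner)
qed

lemma norm_scaleC: "norm (c *\<^sub>C x) = cmod c * norm (x :: 'a::complex_inner)"
proof -
  have "cinner (c *\<^sub>C x) (c *\<^sub>C x) = c * cnj c * cinner x x"
    by (metis (no_types, lifting) cinner_commute cinner_scaleC_left complex_cnj_mult mult.assoc mult.commute)
  also have "\<dots> = complex_of_real ((cmod c * norm x)\<^sup>2)"
    by (simp only: cinner_self complex_mult_cnj cmod_power2[symmetric] of_real_mult[symmetric] power_mult_distrib)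
  finally have "(norm (c *\<^sub>C x))\<^sup>2 = (cmod c * norm x)\<^sup>2"
    unfolding cinner_self of_real_eq_iff .
  then show ?thesis
    by (simp add: power2_eq_iff_nonneg)
qed

lemma bounded_linear_scaleC: "bounded_linear (\<lambda>x :: 'a::complex_inner. c *\<^sub>C x)"
proof (rule bounded_linear_intro[where K = "cmod c"])
  show "c *\<^sub>C (x + y) = c *\<^sub>C x + c *\<^sub>C y" for x y :: 'a
    by (rule scaleC_add_right)
  show "c *\<^sub>C (r *\<^sub>R x) = r *\<^sub>R (c *\<^sub>C x)" for r and x :: 'a
    by (simp add: scaleR_scaleC scaleC_scaleC mult.commute)
  show "norm (c *\<^sub>C x) \<le> norm x * cmod c" for x :: 'a
    by (simp add: norm_scaleC mult.commute)
qed

instantiation blinfun :: (real_normed_vector, complex_inner) complex_vector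
begin

lift_definition scaleC_blinfun :: "complex \<Rightarrow> ('a \<Rightarrow>\<^sub>L 'b) \<Rightarrow> ('a \<Rightarrow>\<^sub>L 'b)"
  is "\<lambda>c f x. c *\<^sub>C f x"
  by (rule bounded_linear_compose[OF bounded_linear_scaleC])

instance
  by standard
    (transfer; simp add: fun_eq_iff scaleC_add_right scaleC_add_left scaleC_scaleC scaleC_one scaleR_scaleC)+

end

subsection \<open>Operators\<close>

text \<open>The type \<open>'h \<Rightarrow>\<^sub>L 'h\<close> consists of the bounded real-linear operators; the bounded operators of
  a complex Hilbert space are those among them that are complex-linear. The norm of the type
  is the operator norm.\<close>

definition bounded_ops :: "('h::complex_inner \<Rightarrow>\<^sub>L 'h) set" where
  "bounded_ops = {A. Vector_Spaces.linear scaleC scaleC (blinfun_apply A)}"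

definition cadjoint :: "('h::chilbert_space \<Rightarrow>\<^sub>L 'h) \<Rightarrow> ('h \<Rightarrow>\<^sub>L 'h)" where
  "cadjoint A = (THE B. \<forall>x y. cinner (blinfun_apply A x) y = cinner x (blinfun_apply B y))"

definition unitary_op :: "('h::chilbert_space \<Rightarrow>\<^sub>L 'h) \<Rightarrow> bool" where
  "unitary_op U \<longleftrightarrow> U \<in> bounded_ops \<and>
     cadjoint U o\<^sub>L U = id_blinfun \<and> U o\<^sub>L cadjoint U = id_blinfun"

text \<open>A unitary from one subspace onto another; only the values of \<open>W\<close> on \<open>S\<close> matter.\<close>

definition unitary_between :: "'h::complex_inner set \<Rightarrow> 'h set \<Rightarrow> ('h \<Rightarrow> 'h) \<Rightarrow> bool" where
  "unitary_between S T W \<longleftrightarrow>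
     (\<forall>x\<in>S. \<forall>y\<in>S. W (x + y) = W x + W y) \<and>
     (\<forall>c. \<forall>x\<in>S. W (c *\<^sub>C x) = c *\<^sub>C W x) \<and>
     (\<forall>x\<in>S. \<forall>y\<in>S. cinner (W x) (W y) = cinner x y) \<and>
     W ` S = T"

definition orthonormal_basis :: "'h::chilbert_space set \<Rightarrow> 'h set \<Rightarrow> bool" where
  "orthonormal_basis S B \<longleftrightarrow> B \<subseteq> S \<and>
     (\<forall>x\<in>B. \<forall>y\<in>B. cinner x y = (if x = y then 1 else 0)) \<and> closure (cspan B) = S"

text \<open>All orthonormal bases of a closed subspace are equipotent, so equality of (Hilbert)
  dimensions does not depend on the bases chosen.\<close>

definition same_dim :: "'h::chilbert_space set \<Rightarrow> 'h set \<Rightarrow> bool" where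
  "same_dim S T \<longleftrightarrow> (\<exists>B C. orthonormal_basis S B \<and> orthonormal_basis T C \<and> B \<approx> C)"

subsection \<open>Compact \<open>C\<^sup>*\<close>-algebras\<close>

text \<open>The whole type \<open>'h\<close> is the Hilbert space direct sum of the subspaces \<open>H l\<close> with
  \<open>l \<in> \<Lambda>\<close>. Since families of types are not available, the summands of \<open>\<Oplus>H\<^sub>\<lambda>\<close> are
  represented by their copies inside the sum.\<close>

definition hilbert_direct_sum :: "'l set \<Rightarrow> ('l \<Rightarrow> 'h::chilbert_space set) \<Rightarrow> bool" where
  "hilbert_direct_sum \<Lambda> H \<longleftrightarrow>
     (\<forall>l\<in>\<Lambda>. csubspace (H l) \<and> closed (H l)) \<and>
     (\<forall>l\<in>\<Lambda>. \<forall>m\<in>\<Lambda>. l \<noteq> m \<longrightarrow> (\<forall>x\<in>H l. \<forall>y\<in>H m. cinner x y = 0)) \<and>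
     closure (cspan (\<Union>l\<in>\<Lambda>. H l)) = UNIV"

definition block_diagonal :: "'l set \<Rightarrow> ('l \<Rightarrow> 'h::chilbert_space set) \<Rightarrow> ('h \<Rightarrow>\<^sub>L 'h) \<Rightarrow> bool" where
  "block_diagonal \<Lambda> H A \<longleftrightarrow>
     A \<in> bounded_ops \<and> (\<forall>l\<in>\<Lambda>. blinfun_apply A ` H l \<subseteq> H l)"

definition compact_on :: "'h::chilbert_space set \<Rightarrow> ('h \<Rightarrow>\<^sub>L 'h) \<Rightarrow> bool" where
  "compact_on S A \<longleftrightarrow> compact (closure (blinfun_apply A ` (S \<inter> cball 0 1)))"

definition norm_on :: "'h::chilbert_space set \<Rightarrow> ('h \<Rightarrow>\<^sub>L 'h) \<Rightarrow> real" where
  "norm_on S A = (SUP x \<in> S \<inter> cball 0 1. norm (blinfun_apply A x))"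

text \<open>The \<open>c\<^sub>0\<close>-direct sum of the algebras of compact operators on the \<open>H l\<close>.\<close>

definition compact_sum :: "'l set \<Rightarrow> ('l \<Rightarrow> 'h::chilbert_space set) \<Rightarrow> ('h \<Rightarrow>\<^sub>L 'h) set" where
  "compact_sum \<Lambda> H = {A. block_diagonal \<Lambda> H A \<and> (\<forall>l\<in>\<Lambda>. compact_on (H l) A) \<and>
     (\<forall>\<epsilon>>0. finite {l \<in> \<Lambda>. norm_on (H l) A \<ge> \<epsilon>})}"

subsection \<open>Strong Birkhoff--James orthogonality\<close>

definition strong_BJ :: "('h::chilbert_space \<Rightarrow>\<^sub>L 'h) set \<Rightarrow> ('h \<Rightarrow>\<^sub>L 'h) \<Rightarrow> ('h \<Rightarrow>\<^sub>L 'h) \<Rightarrow> bool" where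
  "strong_BJ \<AA> x y \<longleftrightarrow> (\<forall>z\<in>\<AA>. norm (x + (y o\<^sub>L z)) \<ge> norm x)"

definition strong_BJ_isomorphism ::
    "('h::chilbert_space \<Rightarrow>\<^sub>L 'h) set \<Rightarrow> (('h \<Rightarrow>\<^sub>L 'h) \<Rightarrow> ('h \<Rightarrow>\<^sub>L 'h)) \<Rightarrow> bool" where
  "strong_BJ_isomorphism \<AA> \<Phi> \<longleftrightarrow> bij_betw \<Phi> \<AA> \<AA> \<and>
     (\<forall>x\<in>\<AA>. \<forall>y\<in>\<AA>. strong_BJ \<AA> x y \<longleftrightarrow> strong_BJ \<AA> (\<Phi> x) (\<Phi> y))"

definition complex_linear_on ::
    "('h::chilbert_space \<Rightarrow>\<^sub>L 'h) set \<Rightarrow> (('h \<Rightarrow>\<^sub>L 'h) \<Rightarrow> ('h \<Rightarrow>\<^sub>L 'h)) \<Rightarrow> bool" where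
  "complex_linear_on \<AA> \<Phi> \<longleftrightarrow>
     (\<forall>x\<in>\<AA>. \<forall>y\<in>\<AA>. \<Phi> (x + y) = \<Phi> x + \<Phi> y) \<and>
     (\<forall>c. \<forall>x\<in>\<AA>. \<Phi> (c *\<^sub>C x) = c *\<^sub>C \<Phi> x)"

subsection \<open>The two kinds of maps\<close>

text \<open>The \<open>l\<close>-th block of \<open>\<Psi> A\<close> is \<open>W l \<circ> A\<^bsub>\<phi> l\<^esub> \<circ> (W l)\<^sup>*\<close>, where the adjoint of the
  unitary \<open>W l\<close> from \<open>H (\<phi> l)\<close> onto \<open>H l\<close> is written as its inverse.\<close>

definition block_permutation ::
    "'l set \<Rightarrow> ('l \<Rightarrow> 'h::chilbert_space set) \<Rightarrow> (('h \<Rightarrow>\<^sub>L 'h) \<Rightarrow> ('h \<Rightarrow>\<^sub>L 'h)) \<Rightarrow> bool" where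
  "block_permutation \<Lambda> H \<Psi> \<longleftrightarrow>
     (\<exists>\<phi> W. bij_betw \<phi> \<Lambda> \<Lambda> \<and>
        (\<forall>l\<in>\<Lambda>. same_dim (H (\<phi> l)) (H l) \<and> unitary_between (H (\<phi> l)) (H l) (W l)) \<and>
        (\<forall>A\<in>compact_sum \<Lambda> H. \<Psi> A \<in> compact_sum \<Lambda> H \<and>
           (\<forall>l\<in>\<Lambda>. \<forall>x\<in>H l. blinfun_apply (\<Psi> A) x =
              W l (blinfun_apply A (inv_into (H (\<phi> l)) (W l) x)))))"

text \<open>Unitaries of the form \<open>U = \<Oplus>U\<^sub>\<lambda>\<close>, the block \<open>U\<^sub>\<lambda>\<close> being the restriction to \<open>H\<^sub>\<lambda>\<close>.\<close>

definition block_unitary :: "'l set \<Rightarrow> ('l \<Rightarrow> 'h::chilbert_space set) \<Rightarrow> ('h \<Rightarrow>\<^sub>L 'h) \<Rightarrow> bool" where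
  "block_unitary \<Lambda> H U \<longleftrightarrow> unitary_op U \<and> block_diagonal \<Lambda> H U \<and>
     (\<forall>l\<in>\<Lambda>. unitary_between (H l) (H l) (blinfun_apply U))"

definition unitary_multiplication ::
    "'l set \<Rightarrow> ('l \<Rightarrow> 'h::chilbert_space set) \<Rightarrow> (('h \<Rightarrow>\<^sub>L 'h) \<Rightarrow> ('h \<Rightarrow>\<^sub>L 'h)) \<Rightarrow> bool" where
  "unitary_multiplication \<Lambda> H \<Psi> \<longleftrightarrow>
     (\<exists>U V. block_unitary \<Lambda> H U \<and> block_unitary \<Lambda> H V \<and>
        (\<forall>X\<in>compact_sum \<Lambda> H. \<Psi> X = U o\<^sub>L X o\<^sub>L cadjoint V))"

end

theory Submission
  imports Defs
begin

text \<open>Write \<open>u \<otimes> v\<^sup>*\<close> for the operator \<open>x \<mapsto> cinner x v *\<^sub>C u\<close>. Everything rests on one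
  computation: for nonzero \<open>\<xi>\<close> and \<open>w\<close> in the same block, \<open>\<xi> \<otimes> w\<^sup>*\<close> is strongly orthogonal to
  \<open>y\<close> iff the range of \<open>y\<close> is orthogonal to \<open>\<xi>\<close> (\<open>strong_BJ_rank_one_iff\<close>). So the strong
  orthogonality relation knows the closed range of every element.

  Order the algebra by letting \<open>y' \<le> y\<close> if everything strongly orthogonal to \<open>y\<close> is strongly
  orthogonal to \<open>y'\<close>. The minimal nonzero elements are the operators of rank one inside a block,
  and the elements below \<open>u \<otimes> w\<^sup>*\<close> are the \<open>u \<otimes> v\<^sup>*\<close> with \<open>v\<close> in that block. An isomorphism
  \<open>\<Phi>\<close> therefore preserves rank one and the rows \<open>{u \<otimes> v\<^sup>* | v}\<close>, and linearity forces
  \<open>\<Phi> (u \<otimes> v\<^sup>*) = D u \<otimes> (C v)\<^sup>*\<close> on each block, with linear bijections \<open>D\<close> and \<open>C\<close> onto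
  another block (\<open>block_form_exists\<close>). Transposition, which turns rows into columns, is thereby
  excluded in dimension greater than one.

  The relation also sees orthogonality of vectors. Applied to rank-one operators it shows that \<open>D\<close>
  preserves orthogonality; applied to \<open>e \<otimes> e\<^sup>* + e' \<otimes> e'\<^sup>*\<close> for orthonormal \<open>e\<close>, \<open>e'\<close>, it shows the
  same for \<open>C\<close> and makes \<open>norm (D e) * norm (C e)\<close> independent of the unit vector \<open>e\<close>, across all
  blocks. A linear map preserving orthogonality is a multiple of an isometry, so after division by
  one scalar \<open>\<alpha>\<close> the maps \<open>D\<close> and \<open>C\<close> may be taken unitary (\<open>unitary_block_form\<close>).

  Finally \<open>\<Phi> X\<close> is determined for arbitrary \<open>X\<close> without any continuity of \<open>\<Phi>\<close>: for each \<open>\<xi>\<close> some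
  rank-one \<open>F\<close> satisfies \<open>(X - F)\<^sup>* \<xi> = 0\<close>, a relation that \<open>\<Phi>\<close> preserves (\<open>image_apply\<close>). This gives
  \<open>\<Phi> X = \<alpha> D X C\<^sup>*\<close> blockwise. Conjugation by \<open>C\<close> is the permutation of blocks, and what remains is
  left multiplication by the unitary with blocks \<open>C\<^sup>* D\<close>.\<close>

section \<open>Complex inner products\<close>

lemma cinner_add_right: "cinner x (y + z) = cinner x y + cinner x (z :: 'a::complex_inner)"
  by (metis cinner_add_left cinner_commute complex_cnj_add)

lemma cinner_scaleC_right: "cinner x (c *\<^sub>C y) = cnj c * cinner x (y :: 'a::complex_inner)"
  by (metis cinner_scaleC_left cinner_commute complex_cnj_mult)

lemma scaleC_minus_one: "(- 1) *\<^sub>C x = - (x :: 'a::complex_vector)"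
  by (metis complex_vector.scale_minus_left scaleC_one)

lemma cinner_minus_left: "cinner (- x) y = - cinner x (y :: 'a::complex_inner)"
  using cinner_scaleC_left[of "-1" x y] by (simp add: scaleC_minus_one)

lemma cinner_minus_right: "cinner x (- y) = - cinner x (y :: 'a::complex_inner)"
  using cinner_scaleC_right[of x "-1" y] by (simp add: scaleC_minus_one)

lemma cinner_diff_left: "cinner (x - y) z = cinner x z - cinner y (z :: 'a::complex_inner)"
  using cinner_add_left[of x "- y" z] by (simp add: cinner_minus_left)

lemma cinner_diff_right: "cinner x (y - z) = cinner x y - cinner x (z :: 'a::complex_inner)"
  using cinner_add_right[of x y "- z"] by (simp add: cinner_minus_right)

lemma cinner_zero_left [simp]: "cinner 0 (y :: 'a::complex_inner) = 0"
  using cinner_diff_left[of 0 0 y] by simp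

lemma cinner_zero_right [simp]: "cinner (y :: 'a::complex_inner) 0 = 0"
  using cinner_diff_right[of y 0 0] by simp

lemmas cinner_simps = cinner_add_left cinner_add_right cinner_diff_left cinner_diff_right
  cinner_scaleC_left cinner_scaleC_right cinner_minus_left cinner_minus_right

lemma cinner_self_eq_0 [simp]: "cinner x x = 0 \<longleftrightarrow> x = (0 :: 'a::complex_inner)"
  by (simp add: cinner_self)

lemma cinner_eq_0_sym: "cinner x y = 0 \<Longrightarrow> cinner y (x :: 'a::complex_inner) = 0"
  by (metis cinner_commute complex_cnj_zero)

lemma cinner_eq_inner: "cinner x (y :: 'a::complex_inner) = Complex (inner x y) (inner x (\<i> *\<^sub>C y))"
  by (simp add: complex_eq_iff inner_eq_Re_cinner cinner_scaleC_right)

lemma bounded_linear_cinner_left: "bounded_linear (\<lambda>x :: 'a::complex_inner. cinner x y)"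
  unfolding cinner_eq_inner Complex_eq
  by (intro bounded_linear_add bounded_linear_const_mult bounded_linear_compose[OF bounded_linear_of_real]
      bounded_linear_inner_left)

lemma bounded_linear_cinner_right: "bounded_linear (\<lambda>y :: 'a::complex_inner. cinner x y)"
proof -
  have "(\<lambda>y. cinner x y) = (\<lambda>y. cnj (cinner y x))"
    by (metis cinner_commute)
  then show ?thesis
    using bounded_linear_compose[OF bounded_linear_cnj bounded_linear_cinner_left[of x]] by simp
qed

lemma norm_diff_sq:
  "(norm (x - y :: 'a::complex_inner))\<^sup>2 = (norm x)\<^sup>2 + (norm y)\<^sup>2 - 2 * Re (cinner x y)"
  unfolding inner_eq_Re_cinner[symmetric] by (simp add: power2_norm_eq_inner algebra_simps inner_commute)

lemma norm_add_orthogonal_sq: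
  "cinner x y = 0 \<Longrightarrow> (norm (x + y :: 'a::complex_inner))\<^sup>2 = (norm x)\<^sup>2 + (norm y)\<^sup>2"
  using norm_diff_sq[of x "- y"] by (simp add: cinner_minus_right)

lemma cmod_cinner_le: "cmod (cinner x y) \<le> norm x * norm (y :: 'a::complex_inner)"
proof (cases "cinner x y = 0")
  case False
  \<comment> \<open>A phase that turns the complex inner product into a real one.\<close>
  define c where "c = cnj (cinner x y) / cmod (cinner x y)"
  have "c * cinner x y = complex_of_real (cmod (cinner x y))"
  proof -
    have "c * cinner x y = (cinner x y * cnj (cinner x y)) / cmod (cinner x y)"
      by (simp add: c_def)
    also have "\<dots> = complex_of_real ((cmod (cinner x y))\<^sup>2) / cmod (cinner x y)"
      by (simp only: complex_norm_square)
    finally show ?thesis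
      using False by (simp add: power2_eq_square)
  qed
  then have "cmod (cinner x y) = inner (c *\<^sub>C x) y"
    by (simp add: inner_eq_Re_cinner cinner_scaleC_left)
  also have "\<dots> \<le> norm (c *\<^sub>C x) * norm y"
    by (rule norm_cauchy_schwarz)
  also have "\<dots> = norm x * norm y"
    using False by (simp add: norm_scaleC c_def norm_divide)
  finally show ?thesis .
qed simp

lemma cinner_orthogonal_component:
  assumes "y \<noteq> (0 :: 'a::complex_inner)"
  shows "cinner (x - (cinner x y / cinner y y) *\<^sub>C y) y = 0"
  using assms by (simp add: cinner_simps)

lemma csubspace_imp_subspace: "csubspace (S :: 'a::complex_vector set) \<Longrightarrow> subspace S"
  unfolding complex_vector.subspace_def subspace_def by (simp add: scaleR_scaleC)

lemma tendsto_scaleC: "(f \<longlongrightarrow> l) F \<Longrightarrow> ((\<lambda>x. c *\<^sub>C f x) \<longlongrightarrow> c *\<^sub>C (l :: 'a::complex_inner)) F"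
  by (rule bounded_linear.tendsto[OF bounded_linear_scaleC])

lemma orthogonal_closure_cspan:
  fixes x :: "'a::complex_inner"
  assumes "\<And>b. b \<in> B \<Longrightarrow> cinner x b = 0" "y \<in> closure (cspan B)"
  shows "cinner x y = 0"
proof -
  have "csubspace {y. cinner x y = 0}"
    by (auto simp: complex_vector.subspace_def cinner_simps)
  then have "cspan B \<subseteq> {y. cinner x y = 0}"
    using assms(1) by (intro complex_vector.span_minimal) auto
  moreover have "closed {y. cinner x y = 0}"
    by (intro closed_Collect_eq continuous_on_const linear_continuous_on bounded_linear_cinner_right)
  ultimately have "closure (cspan B) \<subseteq> {y. cinner x y = 0}"
    by (rule closure_minimal)
  then show ?thesis
    using assms(2) by blast
qed

lemma subspace_closure:
  fixes S :: "'a::real_normed_vector set"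
  assumes "subspace S"
  shows "subspace (closure S)"
  unfolding subspace_def
proof (intro conjI ballI allI)
  show "0 \<in> closure S"
    using closure_subset subspace_0[OF assms] by blast
  show "x + y \<in> closure S" if xy: "x \<in> closure S" "y \<in> closure S" for x y
  proof -
    obtain f g where "\<And>n. f n \<in> S" "f \<longlonglongrightarrow> x" "\<And>n. g n \<in> S" "g \<longlonglongrightarrow> y"
      using xy unfolding closure_sequential by metis
    then show ?thesis
      unfolding closure_sequential using subspace_add[OF assms]
      by (intro exI[of _ "\<lambda>n. f n + g n"]) (auto intro: tendsto_add)
  qed
  show "c *\<^sub>R x \<in> closure S" if x: "x \<in> closure S" for c x
  proof -
    obtain f where "\<And>n. f n \<in> S" "f \<longlonglongrightarrow> x"
      using x unfolding closure_sequential by metis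
    then show ?thesis
      unfolding closure_sequential using subspace_scale[OF assms]
      by (intro exI[of _ "\<lambda>n. c *\<^sub>R f n"]) (auto intro: tendsto_scaleR)
  qed
qed

section \<open>Orthogonal projections and orthonormal bases\<close>

lemma closest_point_in_closed_subspace:
  fixes M :: "'a::{real_inner,complete_space} set"
  assumes "subspace M" "closed M"
  obtains p where "p \<in> M" "\<And>m. m \<in> M \<Longrightarrow> norm (x - p) \<le> norm (x - m)"
proof -
  define D where "D = (\<lambda>m. (norm (x - m))\<^sup>2) ` M"
  define d where "d = Inf D"
  have ne: "D \<noteq> {}"
    using subspace_0[OF assms(1)] by (auto simp: D_def)
  have bdd: "bdd_below D"
    by (rule bdd_belowI[of _ 0]) (auto simp: D_def)
  have d_le: "d \<le> (norm (x - m))\<^sup>2" if "m \<in> M" for m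
    unfolding d_def using that by (intro cInf_lower bdd) (auto simp: D_def)
  have "\<exists>m\<in>M. (norm (x - m))\<^sup>2 < d + 1 / (real n + 1)" for n
    using cInf_lessD[OF ne, of "d + 1 / (real n + 1)"] by (auto simp: d_def D_def)
  then obtain m where m: "\<And>n. m n \<in> M" "\<And>n. (norm (x - m n))\<^sup>2 < d + 1 / (real n + 1)"
    by metis
  \<comment> \<open>By the parallelogram law a minimizing sequence is Cauchy, since midpoints stay in \<open>M\<close>.\<close>
  have close: "(norm (m i - m j))\<^sup>2 \<le> 2 / (real i + 1) + 2 / (real j + 1)" for i j
  proof -
    have "(1/2) *\<^sub>R (m i + m j) \<in> M"
      using assms(1) m(1) by (intro subspace_scale subspace_add)
    then have "d \<le> (norm (x - (1/2) *\<^sub>R (m i + m j)))\<^sup>2"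
      by (rule d_le)
    moreover have "(norm (m i - m j))\<^sup>2 = 2 * (norm (x - m i))\<^sup>2 + 2 * (norm (x - m j))\<^sup>2
        - 4 * (norm (x - (1/2) *\<^sub>R (m i + m j)))\<^sup>2"
      by (simp add: power2_norm_eq_inner algebra_simps inner_commute)
    ultimately show ?thesis
      using m(2)[of i] m(2)[of j] by simp
  qed
  have "Cauchy m"
  proof (rule metric_CauchyI)
    fix e :: real assume "0 < e"
    then obtain N where N: "4 / (e\<^sup>2) < real N"
      using reals_Archimedean2 by blast
    have "dist (m i) (m j) < e" if "i \<ge> N" "j \<ge> N" for i j
    proof -
      have "2 / (real k + 1) < e\<^sup>2 / 2" if "k \<ge> N" for k
      proof -
        have "4 / e\<^sup>2 < real k + 1"
          using N that by linarith
        then show ?thesis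
          using \<open>0 < e\<close> by (simp add: field_simps)
      qed
      from this[OF that(1)] this[OF that(2)] have "(norm (m i - m j))\<^sup>2 < e\<^sup>2"
        using close[of i j] by linarith
      then show ?thesis
        using \<open>0 < e\<close> by (simp add: dist_norm power2_less_imp_less)
    qed
    then show "\<exists>M. \<forall>i\<ge>M. \<forall>j\<ge>M. dist (m i) (m j) < e"
      by blast
  qed
  then obtain p where p: "m \<longlonglongrightarrow> p"
    using Cauchy_convergent convergent_def by blast
  have "p \<in> M"
    using closed_sequentially[OF assms(2) _ p] m(1) by blast
  moreover have "norm (x - p) \<le> norm (x - k)" if "k \<in> M" for k
  proof -
    have "(\<lambda>n. (norm (x - m n))\<^sup>2) \<longlonglongrightarrow> (norm (x - p))\<^sup>2"
      by (intro tendsto_intros p)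
    moreover have "(\<lambda>n. d + 1 / (real n + 1)) \<longlonglongrightarrow> d + 0"
      by (intro tendsto_intros) (use LIMSEQ_inverse_real_of_nat in \<open>simp add: field_simps\<close>)
    ultimately have "(norm (x - p))\<^sup>2 \<le> d + 0"
      by (rule LIMSEQ_le) (use m(2) less_imp_le in blast)
    also have "\<dots> \<le> (norm (x - k))\<^sup>2"
      using d_le[OF that] by simp
    finally show ?thesis
      by (simp add: power2_le_iff_abs_le)
  qed
  ultimately show ?thesis
    using that by blast
qed

lemma orthogonal_projection_exists:
  fixes M :: "'a::{real_inner,complete_space} set"
  assumes "subspace M" "closed M"
  obtains p where "p \<in> M" "\<And>m. m \<in> M \<Longrightarrow> inner (x - p) m = 0"
proof -
  obtain p where p: "p \<in> M" "\<And>m. m \<in> M \<Longrightarrow> norm (x - p) \<le> norm (x - m)"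
    using closest_point_in_closed_subspace[OF assms] by blast
  have "inner (x - p) m = 0" if "m \<in> M" for m
  proof (cases "m = 0")
    case False
    define t where "t = inner (x - p) m / inner m m"
    have "norm (x - p) \<le> norm (x - (p + t *\<^sub>R m))"
      using assms(1) p(1) that by (intro p(2) subspace_add subspace_scale)
    then have "(norm (x - p))\<^sup>2 \<le> (norm ((x - p) - t *\<^sub>R m))\<^sup>2"
      by (simp add: algebra_simps)
    also have "\<dots> = (norm (x - p))\<^sup>2 - 2 * t * inner (x - p) m + t * (t * inner m m)"
      unfolding power2_norm_eq_inner inner_diff_left inner_diff_right by (simp add: algebra_simps inner_commute)
    also have "\<dots> = (norm (x - p))\<^sup>2 - (inner (x - p) m)\<^sup>2 / inner m m"
      using False by (simp add: t_def power2_eq_square)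
    finally have "(inner (x - p) m)\<^sup>2 \<le> 0"
      using False by (simp add: divide_le_0_iff) (metis inner_ge_zero inner_eq_zero_iff order_antisym)
    then show ?thesis
      by simp
  qed simp
  with p(1) show ?thesis
    using that by blast
qed

lemma cinner_eq_0_if_inner_eq_0:
  fixes M :: "'a::complex_inner set"
  assumes "csubspace M" "\<And>m. m \<in> M \<Longrightarrow> inner x m = 0" "m \<in> M"
  shows "cinner x m = 0"
  using assms(2)[OF assms(3)] assms(2)[OF complex_vector.subspace_scale[OF assms(1,3)]]
  by (simp add: cinner_eq_inner complex_eq_iff)

lemma corthogonal_projection_exists:
  fixes M :: "'a::chilbert_space set"
  assumes "csubspace M" "closed M"
  obtains p where "p \<in> M" "\<And>m. m \<in> M \<Longrightarrow> cinner (x - p) m = 0"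
  using orthogonal_projection_exists[OF csubspace_imp_subspace[OF assms(1)] assms(2), of x]
    cinner_eq_0_if_inner_eq_0[OF assms(1)] by metis

text \<open>Riesz representation: a nonzero functional is represented by a multiple of any nonzero vector
  orthogonal to its kernel.\<close>

lemma riesz_representation:
  fixes f :: "'a::chilbert_space \<Rightarrow> complex"
  assumes f: "bounded_linear f" "\<And>c x. f (c *\<^sub>C x) = c * f x"
  obtains v where "\<And>x. f x = cinner x v"
proof (cases "\<forall>x. f x = 0")
  case True
  then show ?thesis
    using that[of 0] by simp
next
  case False
  then obtain a where a: "f a \<noteq> 0"
    by blast
  interpret f: bounded_linear f by (rule f(1))
  define K where "K = {x. f x = 0}"
  have "csubspace K"
    by (auto simp: K_def complex_vector.subspace_def f.add f.zero f(2))
  moreover have "closed K"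
    unfolding K_def by (intro closed_Collect_eq continuous_on_const linear_continuous_on f(1))
  ultimately obtain p where p: "p \<in> K" "\<And>m. m \<in> K \<Longrightarrow> cinner (a - p) m = 0"
    using corthogonal_projection_exists by blast
  define b where "b = a - p"
  have fb: "f b \<noteq> 0"
    using a p(1) by (simp add: b_def K_def f.diff)
  then have b0: "b \<noteq> 0"
    using f.zero by auto
  have "f x = cinner x ((cnj (f b / cinner b b)) *\<^sub>C b)" for x
  proof -
    have "x - (f x / f b) *\<^sub>C b \<in> K"
      using fb by (simp add: K_def f.diff f(2))
    then have "cinner b (x - (f x / f b) *\<^sub>C b) = 0"
      unfolding b_def by (rule p(2))
    then have "cinner (x - (f x / f b) *\<^sub>C b) b = 0"
      by (rule cinner_eq_0_sym)
    then have "cinner x b = (f x / f b) * cinner b b"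
      by (simp add: cinner_simps)
    then show ?thesis
      using fb b0 by (simp add: cinner_scaleC_right)
  qed
  then show ?thesis
    using that by blast
qed

text \<open>A maximal orthonormal subset is total, because the component of a vector orthogonal to the
  closed span would enlarge it.\<close>

lemma orthonormal_basis_iff_maximal:
  fixes S :: "'a::chilbert_space set"
  assumes "csubspace S" "closed S"
  shows "orthonormal_basis S B \<longleftrightarrow> B \<subseteq> S \<and>
    (\<forall>x\<in>B. \<forall>y\<in>B. cinner x y = (if x = y then 1 else 0)) \<and>
    (\<forall>x\<in>S. (\<forall>b\<in>B. cinner x b = 0) \<longrightarrow> x = 0)"
    (is "_ \<longleftrightarrow> ?sub \<and> ?on \<and> ?max")
proof -
  have total: "closure (cspan B) = S \<longleftrightarrow> ?max" if "?sub"
  proof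
    assume cl: "closure (cspan B) = S"
    show ?max
      using cl orthogonal_closure_cspan cinner_self_eq_0 by blast
  next
    assume max: ?max
    have sub: "cspan B \<subseteq> S"
      using that assms(1) by (rule complex_vector.span_minimal)
    then have clsub: "closure (cspan B) \<subseteq> S"
      using assms(2) by (rule closure_minimal)
    have "x \<in> closure (cspan B)" if "x \<in> S" for x
    proof -
      have "subspace (closure (cspan B))"
        by (intro subspace_closure csubspace_imp_subspace complex_vector.subspace_span)
      then obtain p where p: "p \<in> closure (cspan B)" "\<And>m. m \<in> closure (cspan B) \<Longrightarrow> inner (x - p) m = 0"
        using orthogonal_projection_exists[OF _ closed_closure] by blast
      have "cinner (x - p) b = 0" if "b \<in> B" for b
        using complex_vector.subspace_span _ complex_vector.span_base[OF that]
        by (rule cinner_eq_0_if_inner_eq_0) (use p(2) closure_subset in blast)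
      moreover have "x - p \<in> S"
        using assms(1) that p(1) clsub by (auto intro: complex_vector.subspace_diff)
      ultimately have "x - p = 0"
        using max by blast
      with p(1) show ?thesis
        by simp
    qed
    with clsub show "closure (cspan B) = S"
      by blast
  qed
  show ?thesis
    unfolding orthonormal_basis_def by (intro conj_cong refl total)
qed

lemma orthonormal_basis_exists:
  fixes S :: "'a::chilbert_space set"
  assumes "csubspace S" "closed S"
  obtains B where "orthonormal_basis S B"
proof -
  define \<O> where "\<O> = {B. B \<subseteq> S \<and> (\<forall>x\<in>B. \<forall>y\<in>B. cinner x y = (if x = y then 1 else 0))}"
  have "\<exists>M\<in>\<O>. \<forall>X\<in>\<O>. M \<subseteq> X \<longrightarrow> X = M"
  proof (rule subset_Zorn')
    fix \<C> assume "subset.chain \<O> \<C>"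
    then have sub: "\<C> \<subseteq> \<O>" and chain: "\<And>X Y. X \<in> \<C> \<Longrightarrow> Y \<in> \<C> \<Longrightarrow> X \<subseteq> Y \<or> Y \<subseteq> X"
      by (auto simp: subset_chain_def)
    have "cinner x y = (if x = y then 1 else 0)" if "x \<in> X" "X \<in> \<C>" "y \<in> Y" "Y \<in> \<C>" for x y X Y
      using chain[OF that(2,4)] that sub unfolding \<O>_def by blast
    then show "\<Union>\<C> \<in> \<O>"
      using sub unfolding \<O>_def by blast
  qed
  then obtain M where M: "M \<in> \<O>" "\<And>X. X \<in> \<O> \<Longrightarrow> M \<subseteq> X \<Longrightarrow> X = M"
    by blast
  have "x = 0" if "x \<in> S" and orth: "\<forall>b\<in>M. cinner x b = 0" for x
  proof (rule ccontr)
    assume "x \<noteq> 0"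
    define e where "e = (1 / complex_of_real (norm x)) *\<^sub>C x"
    have "cinner e e = 1"
      using \<open>x \<noteq> 0\<close> by (simp add: cinner_self e_def norm_scaleC norm_divide)
    moreover have "cinner e b = 0" "cinner b e = 0" if "b \<in> M" for b
      using orth that cinner_eq_0_sym by (auto simp: e_def cinner_simps)
    moreover have "e \<in> S"
      unfolding e_def by (intro complex_vector.subspace_scale assms(1) that)
    ultimately have "insert e M \<in> \<O>" "e \<notin> M"
      using M(1) by (force simp: \<O>_def)+
    then show False
      using M(2)[of "insert e M"] by blast
  qed
  then have "orthonormal_basis S M"
    using M(1) unfolding orthonormal_basis_iff_maximal[OF assms] by (auto simp: \<O>_def)
  then show ?thesis
    using that by blast
qed

lemma same_dim_if_unitary_between:
  fixes S T :: "'a::chilbert_space set"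
  assumes S: "csubspace S" "closed S" and T: "csubspace T" "closed T" and W: "unitary_between S T W"
  shows "same_dim S T"
proof -
  obtain B where B: "orthonormal_basis S B"
    using orthonormal_basis_exists[OF S] by blast
  have W_inner: "\<And>x y. x \<in> S \<Longrightarrow> y \<in> S \<Longrightarrow> cinner (W x) (W y) = cinner x y" and W_onto: "W ` S = T"
    using W by (auto simp: unitary_between_def)
  have B': "B \<subseteq> S" "\<And>x y. x \<in> B \<Longrightarrow> y \<in> B \<Longrightarrow> cinner x y = (if x = y then 1 else 0)"
    "\<And>x. x \<in> S \<Longrightarrow> (\<And>b. b \<in> B \<Longrightarrow> cinner x b = 0) \<Longrightarrow> x = 0"
    using B unfolding orthonormal_basis_iff_maximal[OF S] by auto
  have W_orth: "cinner (W x) (W y) = (if x = y then 1 else 0)" if "x \<in> B" "y \<in> B" for x y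
    using W_inner[OF subsetD[OF B'(1) that(1)] subsetD[OF B'(1) that(2)]] B'(2)[OF that] by simp
  have inj: "inj_on W B"
    by (rule inj_onI) (metis W_orth zero_neq_one)
  have zero: "W 0 = 0"
  proof -
    have "0 \<in> S" using S(1) by (rule complex_vector.subspace_0)
    from W_inner[OF this this] show ?thesis by simp
  qed
  have "orthonormal_basis T (W ` B)"
    unfolding orthonormal_basis_iff_maximal[OF T]
  proof (intro conjI ballI impI)
    show "W ` B \<subseteq> T"
      using B'(1) W_onto by blast
    show "cinner x y = (if x = y then 1 else 0)" if "x \<in> W ` B" "y \<in> W ` B" for x y
      using that W_orth inj by (auto simp: inj_on_def)
    fix x assume "x \<in> T" and orth: "\<forall>b\<in>W ` B. cinner x b = 0"
    then obtain a where a: "a \<in> S" "x = W a"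
      using W_onto by blast
    have "cinner a b = 0" if "b \<in> B" for b
      using orth W_inner[OF a(1), of b] a(2) B'(1) that by auto
    then have "a = 0"
      using B'(3) a(1) by blast
    then show "x = 0"
      using a(2) zero by simp
  qed
  moreover have "B \<approx> W ` B"
    using inj by (meson bij_betw_imageI eqpoll_def)
  ultimately show ?thesis
    unfolding same_dim_def using B by blast
qed

section \<open>Maps preserving inner products\<close>

lemma cinner_scaleR_left: "cinner (r *\<^sub>R x) (y :: 'a::complex_inner) = of_real r * cinner x y"
  by (simp add: scaleR_scaleC cinner_scaleC_left)

lemma cinner_scaleR_right: "cinner x (r *\<^sub>R y :: 'a::complex_inner) = of_real r * cinner x y"
  by (simp add: scaleR_scaleC cinner_scaleC_right)

lemma tendsto_cinner:
  fixes f g :: "'b \<Rightarrow> 'a::complex_inner"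
  assumes "(f \<longlongrightarrow> a) F" "(g \<longlongrightarrow> b) F"
  shows "((\<lambda>x. cinner (f x) (g x)) \<longlongrightarrow> cinner a b) F"
  unfolding cinner_eq_inner by (intro tendsto_Complex tendsto_inner tendsto_scaleC assms)

text \<open>Preserving inner products already implies linearity: the vectors \<open>W (x + y) - W x - W y\<close> and \<open>W (c *\<^sub>C x) - c *\<^sub>C W x\<close>
  have norm zero, as one sees by expanding their inner squares.\<close>

lemma unitary_between_if_cinner_preserving:
  fixes S :: "'a::complex_inner set"
  assumes S: "csubspace S"
    and W: "\<And>x y. x \<in> S \<Longrightarrow> y \<in> S \<Longrightarrow> cinner (W x) (W y) = cinner x y"
    and onto: "W ` S = T"
  shows "unitary_between S T W"
proof -
  have "W (x + y) = W x + W y" if "x \<in> S" "y \<in> S" for x y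
  proof -
    have xy: "x + y \<in> S"
      using S that by (rule complex_vector.subspace_add)
    have "cinner (W (x + y) - (W x + W y)) (W (x + y) - (W x + W y)) = 0"
      using that xy by (simp add: cinner_simps W)
    then show ?thesis
      by simp
  qed
  moreover have "W (c *\<^sub>C x) = c *\<^sub>C W x" if "x \<in> S" for c x
  proof -
    have cx: "c *\<^sub>C x \<in> S"
      using S that by (rule complex_vector.subspace_scale)
    have "cinner (W (c *\<^sub>C x) - c *\<^sub>C W x) (W (c *\<^sub>C x) - c *\<^sub>C W x) = 0"
      using that cx by (simp add: cinner_simps W)
    then show ?thesis
      by simp
  qed
  ultimately show ?thesis
    using W onto by (auto simp: unitary_between_def)
qed

lemma unitary_between_norm:
  "unitary_between S T W \<Longrightarrow> x \<in> S \<Longrightarrow> norm (W x) = norm (x :: 'a::complex_inner)"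
  unfolding unitary_between_def norm_eq_sqrt_inner inner_eq_Re_cinner by simp

lemma unitary_between_inj_on:
  fixes S :: "'a::complex_inner set"
  assumes "csubspace S" "unitary_between S T W"
  shows "inj_on W S"
proof (rule inj_onI)
  fix x y assume xy: "x \<in> S" "y \<in> S" "W x = W y"
  have W: "\<And>x y. x \<in> S \<Longrightarrow> y \<in> S \<Longrightarrow> cinner (W x) (W y) = cinner x y"
    using assms(2) by (auto simp: unitary_between_def)
  have "cinner (x - y) (x - y) = 0"
    using W[OF xy(1) xy(1)] W[OF xy(1) xy(2)] W[OF xy(2) xy(1)] W[OF xy(2) xy(2)] xy(3)
    by (simp add: cinner_simps)
  then show "x = y"
    by simp
qed

lemma unitary_between_inv_into:
  fixes S :: "'a::complex_inner set"
  assumes "csubspace S" "csubspace T" "unitary_between S T W"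
  shows "unitary_between T S (inv_into S W)"
proof (rule unitary_between_if_cinner_preserving)
  have W: "\<And>x y. x \<in> S \<Longrightarrow> y \<in> S \<Longrightarrow> cinner (W x) (W y) = cinner x y" "W ` S = T"
    using assms(3) by (auto simp: unitary_between_def)
  note inj = unitary_between_inj_on[OF assms(1,3)]
  show "inv_into S W ` T = S"
    using W(2) inj by (metis bij_betw_def bij_betw_inv_into)
  fix x y assume "x \<in> T" "y \<in> T"
  then show "cinner (inv_into S W x) (inv_into S W y) = cinner x y"
    using W(1)[of "inv_into S W x" "inv_into S W y"] W(2)
    by (simp add: inv_into_into f_inv_into_f)
qed (rule assms)

lemma unitary_between_comp:
  assumes "unitary_between S T W" "unitary_between T R W'"
  shows "unitary_between S R (W' \<circ> W)"
proof -
  have "W x \<in> T" if "x \<in> S" for x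
    using assms(1) that by (auto simp: unitary_between_def)
  then show ?thesis
    using assms unfolding unitary_between_def by (auto simp: image_comp[symmetric])
qed

text \<open>Take the span \<open>G\<close> of the graph of \<open>f\<close>. Inner products of first and of second components
  agree on \<open>G\<close>, hence also on its closure, which is therefore the graph of an isometry. Its domain is
  everything, since a convergent sequence in the span of \<open>S\<close> lifts to a Cauchy sequence in \<open>G\<close>.\<close>

lemma isometric_extension:
  fixes S :: "'a::chilbert_space set"
  assumes scale: "\<And>c x. x \<in> S \<Longrightarrow> c *\<^sub>C x \<in> S"
    and total: "\<And>x. (\<And>s. s \<in> S \<Longrightarrow> cinner x s = 0) \<Longrightarrow> x = 0"
    and f: "\<And>x y. x \<in> S \<Longrightarrow> y \<in> S \<Longrightarrow> cinner (f x) (f y :: 'a) = cinner x y"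
  obtains U :: "'a \<Rightarrow>\<^sub>L 'a" where "U \<in> bounded_ops" "\<And>x. x \<in> S \<Longrightarrow> U x = f x"
    "\<And>x y. cinner (U x) (U y) = cinner x y"
proof -
  define G where "G = span ((\<lambda>x. (x, f x)) ` S)"
  have dense: "closure (span S) = UNIV"
  proof -
    have "x \<in> closure (span S)" for x
    proof -
      have "subspace (closure (span S))"
        by (intro subspace_closure subspace_span)
      then obtain p where p: "p \<in> closure (span S)" "\<And>m. m \<in> closure (span S) \<Longrightarrow> inner (x - p) m = 0"
        using orthogonal_projection_exists[OF _ closed_closure] by blast
      have "inner (x - p) s = 0" if "s \<in> S" for s
        using p(2) closure_subset span_base[OF that] by blast
      then have "x - p = 0"
        by (intro total) (simp add: cinner_eq_inner scale complex_eq_iff)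
      with p(1) show ?thesis
        by simp
    qed
    then show ?thesis
      by blast
  qed
  have G1: "cinner (snd p) (f s) = cinner (fst p) s" if "p \<in> G" "s \<in> S" for p s
    using that(1) unfolding G_def
  proof (rule span_induct)
    show "subspace {p. cinner (snd p) (f s) = cinner (fst p) s}"
      by (auto simp: subspace_def cinner_simps cinner_scaleR_left)
  qed (use that(2) f in auto)
  have G2: "cinner (snd p) (snd q) = cinner (fst p) (fst q)" if "p \<in> G" "q \<in> G" for p q
    using that(2) unfolding G_def
  proof (rule span_induct)
    show "subspace {q. cinner (snd p) (snd q) = cinner (fst p) (fst q)}"
      by (auto simp: subspace_def cinner_simps cinner_scaleR_right)
  qed (use G1 that(1) in auto)
  have G_norm: "norm (snd p) = norm (fst p)" if "p \<in> G" for p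
    using G2[OF that that] by (simp add: norm_eq_sqrt_inner inner_eq_Re_cinner)
  define R where "R x y \<longleftrightarrow> (\<exists>g. (\<forall>n::nat. g n \<in> G) \<and> (\<lambda>n. fst (g n)) \<longlonglongrightarrow> x \<and> (\<lambda>n. snd (g n)) \<longlonglongrightarrow> y)"
    for x y
  have R_cinner: "cinner y y' = cinner x x'" if R: "R x y" "R x' y'" for x y x' y'
  proof -
    obtain g where g: "\<And>n. g n \<in> G" "(\<lambda>n. fst (g n)) \<longlonglongrightarrow> x" "(\<lambda>n. snd (g n)) \<longlonglongrightarrow> y"
      using R(1) unfolding R_def by blast
    obtain h where h: "\<And>n. h n \<in> G" "(\<lambda>n. fst (h n)) \<longlonglongrightarrow> x'" "(\<lambda>n. snd (h n)) \<longlonglongrightarrow> y'"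
      using R(2) unfolding R_def by blast
    have "(\<lambda>n. cinner (fst (g n)) (fst (h n))) \<longlonglongrightarrow> cinner y y'"
      using tendsto_cinner[OF g(3) h(3)] G2[OF g(1) h(1)] by simp
    with tendsto_cinner[OF g(2) h(2)] show ?thesis
      using LIMSEQ_unique by blast
  qed
  have "\<exists>y. R x y" for x
  proof -
    obtain s where s: "\<And>n. s n \<in> span S" "s \<longlonglongrightarrow> x"
      using dense unfolding closure_sequential by (metis UNIV_I closure_sequential)
    have "fst ` G = span (fst ` (\<lambda>x. (x, f x)) ` S)"
      unfolding G_def by (rule linear_span_image[symmetric]) (rule linear_fst)
    then have "span S = fst ` G"
      by (simp add: image_image)
    then have "\<forall>n. \<exists>p. p \<in> G \<and> fst p = s n"
      using s(1) by (metis imageE)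
    then obtain g where g: "\<And>n. g n \<in> G" "\<And>n. fst (g n) = s n"
      by metis
    have "dist (snd (g i)) (snd (g j)) = dist (s i) (s j)" for i j
    proof -
      have "g i - g j \<in> G"
        using g(1) unfolding G_def by (intro span_diff) auto
      from G_norm[OF this] show ?thesis
        by (simp add: dist_norm g(2))
    qed
    moreover have "Cauchy s"
      using s(2) by (rule LIMSEQ_imp_Cauchy)
    ultimately have "Cauchy (\<lambda>n. snd (g n))"
      by (simp add: Cauchy_def)
    then obtain y where "(\<lambda>n. snd (g n)) \<longlonglongrightarrow> y"
      using Cauchy_convergent convergent_def by blast
    then have "R x y"
      unfolding R_def using g s(2) by (intro exI[of _ g]) simp
    then show ?thesis ..
  qed
  then obtain U where U: "\<And>x. R x (U x)"
    by metis
  have U_cinner: "cinner (U x) (U y) = cinner x y" for x y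
    by (rule R_cinner[OF U U])
  have "csubspace (UNIV :: 'a set)"
    by (simp add: complex_vector.subspace_def)
  then have "unitary_between UNIV (range U) U"
    using U_cinner by (rule unitary_between_if_cinner_preserving) auto
  then have U_lin: "U (x + y) = U x + U y" "U (c *\<^sub>C x) = c *\<^sub>C U x" "norm (U x) = norm x" for x y c
    using unitary_between_norm[of UNIV "range U" U x] by (auto simp: unitary_between_def)
  have bl: "bounded_linear U"
    by (rule bounded_linear_intro[where K = 1]) (simp_all add: U_lin scaleR_scaleC)
  have U_S: "U x = f x" if "x \<in> S" for x
  proof -
    have "R x (f x)"
      unfolding R_def G_def using that by (intro exI[of _ "\<lambda>n. (x, f x)"]) (auto intro: span_base)
    then have "cinner (U x - f x) (U x - f x) = 0"
      using U[of x] by (simp add: cinner_simps R_cinner)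
    then show ?thesis
      by simp
  qed
  show ?thesis
  proof (rule that[of "Blinfun U"])
    show "Blinfun U \<in> bounded_ops"
      unfolding bounded_ops_def mem_Collect_eq bounded_linear_Blinfun_apply[OF bl] Vector_Spaces.linear_iff
      using U_lin complex_vector.vector_space_axioms by blast
  qed (simp_all add: bounded_linear_Blinfun_apply[OF bl] U_S U_cinner)
qed

text \<open>Sums and differences of orthogonal vectors of equal norm are orthogonal, so \<open>T\<close> scales all vectors
  of an orthogonal pair by the same factor. Decomposing along one fixed vector \<open>e\<close> gives the same
  factor everywhere, and decomposing \<open>x\<close> along \<open>y\<close> passes from norms to inner products.\<close>

lemma orthogonality_preserving_scaled_isometry:
  fixes S :: "'a::complex_inner set" and T :: "'a \<Rightarrow> 'a"
  assumes S: "csubspace S"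
    and add: "\<And>x y. x \<in> S \<Longrightarrow> y \<in> S \<Longrightarrow> T (x + y) = T x + T y"
    and scale: "\<And>c x. x \<in> S \<Longrightarrow> T (c *\<^sub>C x) = c *\<^sub>C T x"
    and orth: "\<And>x y. x \<in> S \<Longrightarrow> y \<in> S \<Longrightarrow> cinner x y = 0 \<Longrightarrow> cinner (T x) (T y) = 0"
  obtains d where "d \<ge> 0" "\<And>x y. x \<in> S \<Longrightarrow> y \<in> S \<Longrightarrow> cinner (T x) (T y) = complex_of_real d * cinner x y"
proof (cases "S \<subseteq> {0}")
  case True
  have "T 0 = 0"
    using scale[of 0 0] complex_vector.subspace_0[OF S] by simp
  then show ?thesis
    using True by (intro that[of 0]) auto
next
  case False
  then obtain e where e: "e \<in> S" "e \<noteq> 0"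
    by blast
  define d where "d = (norm (T e))\<^sup>2 / (norm e)\<^sup>2"
  note in_S = complex_vector.subspace_add[OF S] complex_vector.subspace_diff[OF S]
    complex_vector.subspace_scale[OF S]
  have diff: "T (x - y) = T x - T y" if "x \<in> S" "y \<in> S" for x y
    using add[OF in_S(2)[OF that] that(2)] by simp
  have same: "norm (T x) = norm (T y)" if "x \<in> S" "y \<in> S" "cinner x y = 0" "norm x = norm y" for x y
  proof -
    have "cinner (x + y) (x - y) = 0"
      using that(3,4) cinner_eq_0_sym[OF that(3)] by (simp add: cinner_simps cinner_self)
    then have "cinner (T (x + y)) (T (x - y)) = 0"
      by (rule orth[OF in_S(1)[OF that(1,2)] in_S(2)[OF that(1,2)]])
    then have "cinner (T x) (T x) = cinner (T y) (T y)"
      using that orth[OF that(1,2,3)] cinner_eq_0_sym[OF orth[OF that(1,2,3)]]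
      by (simp add: add diff cinner_simps)
    then have "complex_of_real ((norm (T x))\<^sup>2) = complex_of_real ((norm (T y))\<^sup>2)"
      by (simp only: cinner_self)
    then show ?thesis
      by (simp only: of_real_eq_iff power2_eq_iff_nonneg norm_ge_zero)
  qed
  have norm_orth: "(norm (T y))\<^sup>2 = d * (norm y)\<^sup>2" if y: "y \<in> S" "cinner y e = 0" for y
  proof -
    let ?x = "complex_of_real (norm e) *\<^sub>C y" and ?z = "complex_of_real (norm y) *\<^sub>C e"
    have "norm (T ?x) = norm (T ?z)"
      using y e by (intro same in_S) (auto simp: cinner_simps norm_scaleC)
    then have "norm e * norm (T y) = norm y * norm (T e)"
      by (simp add: scale y e norm_scaleC)
    then have "(norm e)\<^sup>2 * (norm (T y))\<^sup>2 = (norm y)\<^sup>2 * (norm (T e))\<^sup>2"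
      by (metis power_mult_distrib)
    then show ?thesis
      using e(2) by (simp add: d_def field_simps)
  qed
  have norm_T: "(norm (T x))\<^sup>2 = d * (norm x)\<^sup>2" if x: "x \<in> S" for x
  proof -
    define c where "c = cinner x e / cinner e e"
    define y where "y = x - c *\<^sub>C e"
    have y: "y \<in> S" "cinner y e = 0"
      using x e cinner_orthogonal_component[OF e(2), of x] by (auto simp: y_def c_def intro: in_S)
    have x_eq: "x = y + c *\<^sub>C e"
      by (simp add: y_def)
    have orth_ye: "cinner y (c *\<^sub>C e) = 0" "cinner (T y) (c *\<^sub>C T e) = 0"
      using y orth[OF y(1) e(1) y(2)] by (simp_all add: cinner_scaleC_right)
    have "T x = T y + c *\<^sub>C T e"
      unfolding x_eq using y e in_S by (simp add: add scale)
    then have "(norm (T x))\<^sup>2 = (norm (T y))\<^sup>2 + (cmod c)\<^sup>2 * (norm (T e))\<^sup>2"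
      using norm_add_orthogonal_sq[OF orth_ye(2)] by (simp add: norm_scaleC power_mult_distrib)
    also have "\<dots> = d * ((norm y)\<^sup>2 + (cmod c)\<^sup>2 * (norm e)\<^sup>2)"
      using e(2) by (simp add: norm_orth[OF y]) (simp add: d_def algebra_simps)
    also have "(norm y)\<^sup>2 + (cmod c)\<^sup>2 * (norm e)\<^sup>2 = (norm x)\<^sup>2"
      using norm_add_orthogonal_sq[OF orth_ye(1)] x_eq by (simp add: norm_scaleC power_mult_distrib)
    finally show ?thesis .
  qed
  have "cinner (T x) (T y) = complex_of_real d * cinner x y" if xy: "x \<in> S" "y \<in> S" for x y
  proof (cases "y = 0")
    case True
    then show ?thesis
      using scale[OF xy(2), of 0] by simp
  next
    case False
    define c where "c = cinner x y / cinner y y"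
    define z where "z = x - c *\<^sub>C y"
    have z: "z \<in> S" "cinner z y = 0"
      using xy cinner_orthogonal_component[OF False, of x] by (auto simp: z_def c_def intro: in_S)
    have "x = z + c *\<^sub>C y"
      by (simp add: z_def)
    then have "T x = T z + c *\<^sub>C T y"
      using z xy in_S by (simp add: add scale)
    then have "cinner (T x) (T y) = c * cinner (T y) (T y)"
      using orth[OF z(1) xy(2) z(2)] by (simp add: cinner_simps)
    also have "cinner (T y) (T y) = complex_of_real d * cinner y y"
      by (simp only: cinner_self norm_T[OF xy(2)] of_real_mult)
    finally show ?thesis
      using False by (simp add: c_def)
  qed
  then show ?thesis
    using that[of d] by (simp add: d_def)
qed

section \<open>Operators of rank one\<close>

definition rank_one :: "'a::complex_inner \<Rightarrow> 'a \<Rightarrow> ('a \<Rightarrow>\<^sub>L 'a)" where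
  "rank_one u v = Blinfun (\<lambda>x. cinner x v *\<^sub>C u)"

lemma bounded_linear_scaleC_left: "bounded_linear (\<lambda>c. c *\<^sub>C (u :: 'a::complex_inner))"
  by (rule bounded_linear_intro[where K = "norm u"])
    (simp_all add: scaleC_add_left norm_scaleC scaleR_scaleC scaleC_scaleC scaleR_conv_of_real)

lemma rank_one_apply [simp]: "blinfun_apply (rank_one u v) x = cinner x v *\<^sub>C u"
  unfolding rank_one_def
  by (subst bounded_linear_Blinfun_apply)
    (rule bounded_linear_compose[OF bounded_linear_scaleC_left bounded_linear_cinner_left], simp)

lemma scaleC_blinfun_apply [simp]: "blinfun_apply (c *\<^sub>C A) x = c *\<^sub>C blinfun_apply A x"
  by transfer simp

lemma mem_bounded_ops_iff: "A \<in> bounded_ops \<longleftrightarrow> (\<forall>c x. blinfun_apply A (c *\<^sub>C x) = c *\<^sub>C blinfun_apply A x)"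
  unfolding bounded_ops_def mem_Collect_eq Vector_Spaces.linear_iff
  using complex_vector.vector_space_axioms by (auto simp: blinfun.add_right)

lemma rank_one_bounded_ops: "rank_one u v \<in> bounded_ops"
  by (simp add: mem_bounded_ops_iff cinner_scaleC_left scaleC_scaleC)

lemma rank_one_add_left: "rank_one (u + u') v = rank_one u v + rank_one u' v"
  by (rule blinfun_eqI) (simp add: blinfun.add_left scaleC_add_right)

lemma rank_one_add_right: "rank_one u (v + v') = rank_one u v + rank_one u v'"
  by (rule blinfun_eqI) (simp add: blinfun.add_left scaleC_add_left cinner_add_right)

lemma rank_one_scaleC_left: "rank_one (c *\<^sub>C u) v = c *\<^sub>C rank_one u v"
  by (rule blinfun_eqI) (simp add: scaleC_scaleC mult.commute)

lemma rank_one_scaleC_right: "rank_one u (c *\<^sub>C v) = cnj c *\<^sub>C rank_one u v"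
  by (rule blinfun_eqI) (simp add: scaleC_scaleC cinner_scaleC_right)

lemma rank_one_eq_0_iff: "rank_one u v = 0 \<longleftrightarrow> u = 0 \<or> v = 0"
proof
  assume "rank_one u v = 0"
  then have "blinfun_apply (rank_one u v) v = 0"
    by simp
  then show "u = 0 \<or> v = 0"
    by auto
qed (auto intro: blinfun_eqI)

lemma norm_rank_one: "norm (rank_one u v) = norm u * norm v"
proof (rule antisym)
  show "norm (rank_one u v) \<le> norm u * norm v"
  proof (rule norm_blinfun_bound)
    show "norm (blinfun_apply (rank_one u v) x) \<le> norm u * norm v * norm x" for x
      using mult_left_mono[OF cmod_cinner_le[of x v] norm_ge_zero[of u]]
      by (simp add: norm_scaleC mult_ac)
  qed simp
  show "norm u * norm v \<le> norm (rank_one u v)"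
  proof (cases "v = 0")
    case False
    have "norm (blinfun_apply (rank_one u v) v) \<le> norm (rank_one u v) * norm v"
      by (rule norm_blinfun)
    then have "(norm u * norm v) * norm v \<le> norm (rank_one u v) * norm v"
      by (simp add: norm_scaleC cinner_self power2_eq_square norm_mult mult_ac)
    then show ?thesis
      using False by simp
  qed simp
qed

lemma rank_one_cancel_left: "rank_one u v = rank_one u v' \<Longrightarrow> u \<noteq> 0 \<Longrightarrow> v = v'"
proof -
  assume eq: "rank_one u v = rank_one u v'" and u: "u \<noteq> 0"
  have "cinner x v *\<^sub>C u = cinner x v' *\<^sub>C u" for x
    using arg_cong[OF eq, of "\<lambda>A. blinfun_apply A x"] by simp
  then have "cinner x v = cinner x v'" for x
    using u by simp
  then have "cinner (v - v') (v - v') = 0"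
    by (simp add: cinner_diff_right)
  then show "v = v'"
    by simp
qed

lemma rank_one_cancel_right: "rank_one u v = rank_one u' v \<Longrightarrow> v \<noteq> 0 \<Longrightarrow> u = u'"
proof -
  assume eq: "rank_one u v = rank_one u' v" and v: "v \<noteq> 0"
  have "cinner v v *\<^sub>C u = cinner v v *\<^sub>C u'"
    using arg_cong[OF eq, of "\<lambda>A. blinfun_apply A v"] by simp
  then show "u = u'"
    using v by simp
qed

lemma rank_one_eqD:
  assumes eq: "rank_one u v = rank_one a b" and a: "a \<noteq> 0" and b: "b \<noteq> 0"
  shows "\<exists>c. a = c *\<^sub>C u" "\<exists>c. b = c *\<^sub>C v"
proof -
  have E: "cinner x v *\<^sub>C u = cinner x b *\<^sub>C a" for x
    using arg_cong[OF eq, of "\<lambda>A. blinfun_apply A x"] by simp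
  have "(1 / cinner b b) *\<^sub>C (cinner b v *\<^sub>C u) = (1 / cinner b b) *\<^sub>C (cinner b b *\<^sub>C a)"
    by (simp only: E)
  then have "a = (cinner b v / cinner b b) *\<^sub>C u"
    using b by (simp add: scaleC_scaleC scaleC_one)
  then show "\<exists>c. a = c *\<^sub>C u" ..
  have "cinner x v * cinner u a = cinner x b * cinner a a" for x
    using arg_cong[OF E[of x], of "\<lambda>y. cinner y a"] by (simp add: cinner_scaleC_left)
  then have "cinner x b = cinner x v * cinner u a / cinner a a" for x
    using a by (simp add: eq_divide_eq)
  then have "cinner x b = cinner x (cnj (cinner u a / cinner a a) *\<^sub>C v)" for x
    by (simp add: cinner_scaleC_right mult.commute)
  then have "cinner (b - cnj (cinner u a / cinner a a) *\<^sub>C v) (b - cnj (cinner u a / cinner a a) *\<^sub>C v) = 0"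
    unfolding cinner_diff_right by simp
  then have "b = cnj (cinner u a / cinner a a) *\<^sub>C v"
    unfolding cinner_self_eq_0 by simp
  then show "\<exists>c. b = c *\<^sub>C v" ..
qed

section \<open>The algebra of a block decomposition\<close>

lemma compact_closure_if_subset_compact:
  assumes "X \<subseteq> K" "compact (K :: 'a::t2_space set)"
  shows "compact (closure X)"
  using compact_Int_closed[OF assms(2) closed_closure[of X]] closure_minimal[OF assms(1) compact_imp_closed[OF assms(2)]]
  by (simp add: Int_absorb1)

lemma norm_le_norm_on:
  assumes "x \<in> S" "norm x \<le> 1"
  shows "norm (blinfun_apply A x) \<le> norm_on S A"
  unfolding norm_on_def
proof (rule cSUP_upper)
  show "bdd_above ((\<lambda>x. norm (blinfun_apply A x)) ` (S \<inter> cball 0 1))"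
  proof (rule bdd_aboveI2)
    show "norm (blinfun_apply A x) \<le> norm A" if "x \<in> S \<inter> cball 0 1" for x
      using norm_blinfun[of A x] that mult_left_le[of "norm x" "norm A"] by auto
  qed
qed (use assms in auto)

lemma norm_on_le:
  assumes "csubspace S" "\<And>x. x \<in> S \<Longrightarrow> norm x \<le> 1 \<Longrightarrow> norm (blinfun_apply A x) \<le> K"
  shows "norm_on S A \<le> K"
  unfolding norm_on_def
  using complex_vector.subspace_0[OF assms(1)] assms(2) by (intro cSUP_least) auto

locale hilbert_decomposition =
  fixes \<Lambda> :: "'l set" and H :: "'l \<Rightarrow> 'h::chilbert_space set"
  assumes decomposition: "hilbert_direct_sum \<Lambda> H"
begin

abbreviation \<AA> :: "('h \<Rightarrow>\<^sub>L 'h) set" where "\<AA> \<equiv> compact_sum \<Lambda> H"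

lemma csubspace_H: "l \<in> \<Lambda> \<Longrightarrow> csubspace (H l)"
  and closed_H: "l \<in> \<Lambda> \<Longrightarrow> closed (H l)"
  and orthogonal_H: "l \<in> \<Lambda> \<Longrightarrow> m \<in> \<Lambda> \<Longrightarrow> l \<noteq> m \<Longrightarrow> x \<in> H l \<Longrightarrow> y \<in> H m \<Longrightarrow> cinner x y = 0"
  using decomposition unfolding hilbert_direct_sum_def by blast+

lemma zero_in_H: "l \<in> \<Lambda> \<Longrightarrow> 0 \<in> H l"
  and scaleC_in_H: "l \<in> \<Lambda> \<Longrightarrow> x \<in> H l \<Longrightarrow> c *\<^sub>C x \<in> H l"
  and add_in_H: "l \<in> \<Lambda> \<Longrightarrow> x \<in> H l \<Longrightarrow> y \<in> H l \<Longrightarrow> x + y \<in> H l"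
  and diff_in_H: "l \<in> \<Lambda> \<Longrightarrow> x \<in> H l \<Longrightarrow> y \<in> H l \<Longrightarrow> x - y \<in> H l"
  using csubspace_H complex_vector.subspace_0 complex_vector.subspace_scale
    complex_vector.subspace_add complex_vector.subspace_diff by blast+

lemma block_unique: "l \<in> \<Lambda> \<Longrightarrow> m \<in> \<Lambda> \<Longrightarrow> x \<in> H l \<Longrightarrow> x \<in> H m \<Longrightarrow> x \<noteq> 0 \<Longrightarrow> l = m"
  using orthogonal_H[of l m x x] by auto

lemma eq_0_if_orthogonal_to_blocks:
  assumes "\<And>l y. l \<in> \<Lambda> \<Longrightarrow> y \<in> H l \<Longrightarrow> cinner x y = 0"
  shows "x = 0"
proof -
  have "cinner x x = 0"
    by (rule orthogonal_closure_cspan[of "\<Union>l\<in>\<Lambda>. H l"])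
      (use assms decomposition in \<open>auto simp: hilbert_direct_sum_def\<close>)
  then show ?thesis
    by simp
qed

lemma bounded_ops_eqI:
  assumes "A \<in> bounded_ops" "B \<in> bounded_ops"
    and "\<And>l x. l \<in> \<Lambda> \<Longrightarrow> x \<in> H l \<Longrightarrow> blinfun_apply A x = blinfun_apply B x"
  shows "A = B"
proof (rule blinfun_eqI)
  fix x
  let ?E = "{x. blinfun_apply A x = blinfun_apply B x}"
  have "csubspace ?E"
    using assms(1,2) by (auto simp: complex_vector.subspace_def mem_bounded_ops_iff blinfun.add_right)
  then have "cspan (\<Union>l\<in>\<Lambda>. H l) \<subseteq> ?E"
    using assms(3) by (intro complex_vector.span_minimal) auto
  moreover have "closed ?E"
    by (intro closed_Collect_eq continuous_on_const linear_continuous_on blinfun.bounded_linear_right)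
  ultimately have "closure (cspan (\<Union>l\<in>\<Lambda>. H l)) \<subseteq> ?E"
    by (rule closure_minimal)
  then show "blinfun_apply A x = blinfun_apply B x"
    using decomposition by (auto simp: hilbert_direct_sum_def)
qed

lemma compact_sum_block_diagonal: "A \<in> \<AA> \<Longrightarrow> block_diagonal \<Lambda> H A"
  by (simp add: compact_sum_def)

lemma block_diagonal_bounded_ops: "block_diagonal \<Lambda> H A \<Longrightarrow> A \<in> bounded_ops"
  by (simp add: block_diagonal_def)

lemma block_diagonal_scaleC: "block_diagonal \<Lambda> H A \<Longrightarrow> blinfun_apply A (c *\<^sub>C x) = c *\<^sub>C blinfun_apply A x"
  by (simp add: block_diagonal_def mem_bounded_ops_iff)

lemma block_diagonal_in_H: "block_diagonal \<Lambda> H A \<Longrightarrow> l \<in> \<Lambda> \<Longrightarrow> x \<in> H l \<Longrightarrow> blinfun_apply A x \<in> H l"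
  by (auto simp: block_diagonal_def)

lemma compact_sum_comp:
  assumes B: "block_diagonal \<Lambda> H B" and A: "A \<in> \<AA>"
  shows "B o\<^sub>L A \<in> \<AA>"
  unfolding compact_sum_def mem_Collect_eq
proof (intro conjI ballI allI impI)
  note A' = compact_sum_block_diagonal[OF A]
  show "block_diagonal \<Lambda> H (B o\<^sub>L A)"
    using B A' unfolding block_diagonal_def mem_bounded_ops_iff by (simp add: image_subset_iff)
  show "compact_on (H l) (B o\<^sub>L A)" if "l \<in> \<Lambda>" for l
  proof -
    have "compact (closure (blinfun_apply A ` (H l \<inter> cball 0 1)))"
      using A that by (auto simp: compact_sum_def compact_on_def)
    then have "compact (blinfun_apply B ` closure (blinfun_apply A ` (H l \<inter> cball 0 1)))"
      by (intro compact_continuous_image linear_continuous_on blinfun.bounded_linear_right)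
    moreover have "blinfun_apply (B o\<^sub>L A) ` (H l \<inter> cball 0 1)
        \<subseteq> blinfun_apply B ` closure (blinfun_apply A ` (H l \<inter> cball 0 1))"
      using closure_subset[of "blinfun_apply A ` (H l \<inter> cball 0 1)"] by auto
    ultimately show ?thesis
      unfolding compact_on_def by (intro compact_closure_if_subset_compact)
  qed
  fix e :: real assume "0 < e"
  define K where "K = norm B + 1"
  have K: "K > 0" "norm B \<le> K"
    by (simp_all add: K_def add_nonneg_pos)
  have "e / K \<le> norm_on (H l) A" if "l \<in> \<Lambda>" "e \<le> norm_on (H l) (B o\<^sub>L A)" for l
  proof -
    have "norm_on (H l) (B o\<^sub>L A) \<le> K * norm_on (H l) A"
    proof (rule norm_on_le[OF csubspace_H[OF that(1)]])
      fix x assume x: "x \<in> H l" "norm x \<le> 1"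
      have "norm (blinfun_apply (B o\<^sub>L A) x) \<le> norm B * norm (blinfun_apply A x)"
        by (simp add: norm_blinfun)
      also have "\<dots> \<le> K * norm_on (H l) A"
        using K norm_le_norm_on[OF x] by (intro mult_mono) auto
      finally show "norm (blinfun_apply (B o\<^sub>L A) x) \<le> K * norm_on (H l) A" .
    qed
    then show ?thesis
      using K(1) that(2) by (simp add: field_simps)
  qed
  then have "{l \<in> \<Lambda>. e \<le> norm_on (H l) (B o\<^sub>L A)} \<subseteq> {l \<in> \<Lambda>. e / K \<le> norm_on (H l) A}"
    by blast
  moreover have "finite {l \<in> \<Lambda>. e / K \<le> norm_on (H l) A}"
    using A \<open>0 < e\<close> K(1) by (simp add: compact_sum_def)
  ultimately show "finite {l \<in> \<Lambda>. e \<le> norm_on (H l) (B o\<^sub>L A)}"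
    by (rule finite_subset)
qed

lemma compact_sum_scaleC:
  assumes "A \<in> \<AA>"
  shows "c *\<^sub>C A \<in> \<AA>"
proof -
  have "block_diagonal \<Lambda> H (c *\<^sub>C id_blinfun)"
    using scaleC_in_H by (auto simp: block_diagonal_def mem_bounded_ops_iff scaleC_scaleC mult.commute)
  moreover have "(c *\<^sub>C id_blinfun) o\<^sub>L A = c *\<^sub>C A"
    by (rule blinfun_eqI) simp
  ultimately show ?thesis
    using compact_sum_comp assms by metis
qed

lemma compact_sum_add:
  assumes A: "A \<in> \<AA>" and B: "B \<in> \<AA>"
  shows "A + B \<in> \<AA>"
  unfolding compact_sum_def mem_Collect_eq
proof (intro conjI ballI allI impI)
  show "block_diagonal \<Lambda> H (A + B)"
    using A B add_in_H unfolding compact_sum_def block_diagonal_def mem_bounded_ops_iff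
    by (simp add: image_subset_iff blinfun.add_left scaleC_add_right)
  show "compact_on (H l) (A + B)" if "l \<in> \<Lambda>" for l
  proof -
    let ?C = "\<lambda>A. closure (blinfun_apply A ` (H l \<inter> cball 0 1))"
    have "compact (?C A)" "compact (?C B)"
      using A B that by (auto simp: compact_sum_def compact_on_def)
    then have "compact {x + y | x y. x \<in> ?C A \<and> y \<in> ?C B}"
      by (rule compact_sums)
    moreover have "blinfun_apply (A + B) ` (H l \<inter> cball 0 1) \<subseteq> {x + y | x y. x \<in> ?C A \<and> y \<in> ?C B}"
      using closure_subset[of "blinfun_apply A ` (H l \<inter> cball 0 1)"]
        closure_subset[of "blinfun_apply B ` (H l \<inter> cball 0 1)"]
      by (fastforce simp: blinfun.add_left)
    ultimately show ?thesis
      unfolding compact_on_def by (intro compact_closure_if_subset_compact)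
  qed
  fix e :: real assume "0 < e"
  have "e / 2 \<le> norm_on (H l) A \<or> e / 2 \<le> norm_on (H l) B"
    if "l \<in> \<Lambda>" "e \<le> norm_on (H l) (A + B)" for l
  proof -
    have "norm_on (H l) (A + B) \<le> norm_on (H l) A + norm_on (H l) B"
    proof (rule norm_on_le[OF csubspace_H[OF that(1)]])
      fix x assume x: "x \<in> H l" "norm x \<le> 1"
      show "norm (blinfun_apply (A + B) x) \<le> norm_on (H l) A + norm_on (H l) B"
        unfolding blinfun.add_left
        by (rule norm_triangle_mono[OF norm_le_norm_on[OF x] norm_le_norm_on[OF x]])
    qed
    then show ?thesis
      using that(2) by linarith
  qed
  then have "{l \<in> \<Lambda>. e \<le> norm_on (H l) (A + B)}
      \<subseteq> {l \<in> \<Lambda>. e / 2 \<le> norm_on (H l) A} \<union> {l \<in> \<Lambda>. e / 2 \<le> norm_on (H l) B}"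
    by blast
  moreover have "finite {l \<in> \<Lambda>. e / 2 \<le> norm_on (H l) A}" "finite {l \<in> \<Lambda>. e / 2 \<le> norm_on (H l) B}"
    using A B half_gt_zero[OF \<open>0 < e\<close>] unfolding compact_sum_def by blast+
  ultimately show "finite {l \<in> \<Lambda>. e \<le> norm_on (H l) (A + B)}"
    using finite_subset by blast
qed

lemma compact_sum_diff:
  assumes "A \<in> \<AA>" "B \<in> \<AA>"
  shows "A - B \<in> \<AA>"
proof -
  have "A - B = A + (- 1) *\<^sub>C B"
    by (rule blinfun_eqI) (simp add: blinfun.add_left blinfun.diff_left scaleC_minus_one)
  then show ?thesis
    using compact_sum_add[OF assms(1) compact_sum_scaleC[OF assms(2)]] by metis
qed

lemma rank_one_in_compact_sum:
  assumes l: "l \<in> \<Lambda>" and u: "u \<in> H l" and v: "v \<in> H l"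
  shows "rank_one u v \<in> \<AA>"
  unfolding compact_sum_def mem_Collect_eq
proof (intro conjI ballI allI impI)
  have off: "blinfun_apply (rank_one u v) x = 0" if "m \<in> \<Lambda>" "m \<noteq> l" "x \<in> H m" for m x
    using orthogonal_H[OF that(1) l that(2,3) v] by simp
  then show "block_diagonal \<Lambda> H (rank_one u v)"
    unfolding block_diagonal_def using rank_one_bounded_ops scaleC_in_H[OF l u] zero_in_H
    by (metis (no_types, lifting) image_subsetI rank_one_apply)
  show "compact_on (H m) (rank_one u v)" if "m \<in> \<Lambda>" for m
  proof -
    have "compact ((\<lambda>c. c *\<^sub>C u) ` cball 0 (norm v))"
      by (intro compact_continuous_image linear_continuous_on bounded_linear_scaleC_left compact_cball)
    moreover have "blinfun_apply (rank_one u v) ` (H m \<inter> cball 0 1) \<subseteq> (\<lambda>c. c *\<^sub>C u) ` cball 0 (norm v)"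
    proof (clarsimp, rule imageI)
      fix x :: 'h assume "norm x \<le> 1"
      then have "norm x * norm v \<le> norm v"
        by (simp add: mult_left_le_one_le)
      then show "cinner x v \<in> cball 0 (norm v)"
        using cmod_cinner_le[of x v] by simp
    qed
    ultimately show ?thesis
      unfolding compact_on_def by (intro compact_closure_if_subset_compact)
  qed
  fix e :: real assume "0 < e"
  have "norm_on (H m) (rank_one u v) \<le> 0" if "m \<in> \<Lambda>" "m \<noteq> l" for m
    using off[OF that] by (intro norm_on_le csubspace_H that(1)) simp
  then have "{m \<in> \<Lambda>. e \<le> norm_on (H m) (rank_one u v)} \<subseteq> {l}"
    using \<open>0 < e\<close> by force
  then show "finite {m \<in> \<Lambda>. e \<le> norm_on (H m) (rank_one u v)}"
    by (rule finite_subset) simp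
qed

text \<open>The block-local form of the adjoint: \<open>v\<close> is \<open>A\<^sup>* \<xi>\<close>.\<close>

lemma block_adjoint_exists:
  assumes A: "block_diagonal \<Lambda> H A" and l: "l \<in> \<Lambda>" and \<xi>: "\<xi> \<in> H l"
  obtains v where "v \<in> H l" "\<And>x. cinner (blinfun_apply A x) \<xi> = cinner x v"
proof -
  have "bounded_linear (\<lambda>x. cinner (blinfun_apply A x) \<xi>)"
    by (rule bounded_linear_compose[OF bounded_linear_cinner_left blinfun.bounded_linear_right])
  moreover have "cinner (blinfun_apply A (c *\<^sub>C x)) \<xi> = c * cinner (blinfun_apply A x) \<xi>" for c x
    by (simp add: block_diagonal_scaleC[OF A] cinner_scaleC_left)
  ultimately obtain v where v: "\<And>x. cinner (blinfun_apply A x) \<xi> = cinner x v"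
    using riesz_representation by blast
  obtain p where p: "p \<in> H l" "\<And>m. m \<in> H l \<Longrightarrow> cinner (v - p) m = 0"
    using corthogonal_projection_exists[OF csubspace_H closed_H] l by blast
  have "v - p = 0"
  proof (rule eq_0_if_orthogonal_to_blocks)
    fix m y assume m: "m \<in> \<Lambda>" "y \<in> H m"
    show "cinner (v - p) y = 0"
    proof (cases "m = l")
      case True
      then show ?thesis
        using p(2) m(2) by simp
    next
      case False
      have "cinner y v = 0"
        using orthogonal_H[OF m(1) l False block_diagonal_in_H[OF A m] \<xi>] v by simp
      moreover have "cinner y p = 0"
        by (rule orthogonal_H[OF m(1) l False m(2) p(1)])
      ultimately show ?thesis
        by (simp add: cinner_diff_left cinner_eq_0_sym)
    qed
  qed
  then show ?thesis
    using that[of v] p(1) v by simp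
qed

end

section \<open>Strong orthogonality and operators of rank one\<close>

context hilbert_decomposition
begin

text \<open>If \<open>\<xi>\<close> is orthogonal to the range of \<open>y\<close>, then compressing \<open>\<xi> \<otimes> w\<^sup>* + y z\<close> to \<open>w\<close> and \<open>\<xi>\<close> removes
  \<open>y z\<close>, so the norm cannot drop. Otherwise a rank-one \<open>z\<close> replaces \<open>\<xi>\<close> by its component
  orthogonal to some vector \<open>b\<close> in the range of \<open>y\<close>, which is strictly shorter.\<close>

lemma strong_BJ_rank_one_iff:
  assumes l: "l \<in> \<Lambda>" and \<xi>: "\<xi> \<in> H l" "\<xi> \<noteq> 0" and w: "w \<in> H l" "w \<noteq> 0" and y: "y \<in> \<AA>"
  shows "strong_BJ \<AA> (rank_one \<xi> w) y \<longleftrightarrow> (\<forall>\<eta>\<in>H l. cinner (blinfun_apply y \<eta>) \<xi> = 0)"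
proof
  assume BJ: "strong_BJ \<AA> (rank_one \<xi> w) y"
  show "\<forall>\<eta>\<in>H l. cinner (blinfun_apply y \<eta>) \<xi> = 0"
  proof (intro ballI, rule ccontr)
    fix \<eta> assume \<eta>: "\<eta> \<in> H l" and nz: "cinner (blinfun_apply y \<eta>) \<xi> \<noteq> 0"
    define b where "b = blinfun_apply y \<eta>"
    have b: "b \<noteq> 0" "cinner \<xi> b \<noteq> 0"
      using nz cinner_eq_0_sym by (auto simp: b_def)
    define t where "t = cinner \<xi> b / cinner b b"
    define z where "z = (- t) *\<^sub>C rank_one \<eta> w"
    have "z \<in> \<AA>"
      unfolding z_def by (intro compact_sum_scaleC rank_one_in_compact_sum[OF l] \<eta> w)
    moreover have "rank_one \<xi> w + (y o\<^sub>L z) = rank_one (\<xi> - t *\<^sub>C b) w"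
      by (rule blinfun_eqI)
        (simp add: z_def b_def blinfun.add_left blinfun.minus_left blinfun.minus_right block_diagonal_scaleC[OF compact_sum_block_diagonal[OF y]]
          scaleC_scaleC complex_vector.scale_right_diff_distrib mult.commute)
    ultimately have "norm \<xi> * norm w \<le> norm (\<xi> - t *\<^sub>C b) * norm w"
      using BJ unfolding strong_BJ_def by (metis norm_rank_one)
    then have le: "norm \<xi> \<le> norm (\<xi> - t *\<^sub>C b)"
      using w(2) by simp
    have "cinner (\<xi> - t *\<^sub>C b) (t *\<^sub>C b) = 0"
      using cinner_orthogonal_component[OF b(1), of \<xi>] by (simp add: cinner_scaleC_right t_def)
    then have "(norm \<xi>)\<^sup>2 = (norm (\<xi> - t *\<^sub>C b))\<^sup>2 + (norm (t *\<^sub>C b))\<^sup>2"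
      using norm_add_orthogonal_sq[of "\<xi> - t *\<^sub>C b" "t *\<^sub>C b"] by simp
    moreover have "(norm \<xi>)\<^sup>2 \<le> (norm (\<xi> - t *\<^sub>C b))\<^sup>2"
      using le by (rule power_mono) simp
    ultimately have "t *\<^sub>C b = 0"
      by simp
    then show False
      using b by (auto simp: t_def)
  qed
next
  assume orth: "\<forall>\<eta>\<in>H l. cinner (blinfun_apply y \<eta>) \<xi> = 0"
  show "strong_BJ \<AA> (rank_one \<xi> w) y"
    unfolding strong_BJ_def
  proof
    fix z assume z: "z \<in> \<AA>"
    let ?A = "rank_one \<xi> w + (y o\<^sub>L z)"
    have "cinner (blinfun_apply y (blinfun_apply z w)) \<xi> = 0"
      using orth block_diagonal_in_H[OF compact_sum_block_diagonal[OF z] l w(1)] by blast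
    then have "cinner (blinfun_apply ?A w) \<xi> = cinner w w * cinner \<xi> \<xi>"
      by (simp add: blinfun.add_left cinner_simps)
    then have "(norm w)\<^sup>2 * (norm \<xi>)\<^sup>2 = cmod (cinner (blinfun_apply ?A w) \<xi>)"
      by (simp add: cinner_self norm_mult norm_power)
    also have "\<dots> \<le> norm (blinfun_apply ?A w) * norm \<xi>"
      by (rule cmod_cinner_le)
    also have "\<dots> \<le> (norm ?A * norm w) * norm \<xi>"
      by (intro mult_right_mono norm_blinfun) simp
    finally have "(norm \<xi> * norm w) * (norm w * norm \<xi>) \<le> norm ?A * (norm w * norm \<xi>)"
      by (simp add: power2_eq_square mult_ac)
    then show "norm (rank_one \<xi> w) \<le> norm ?A"
      using \<xi>(2) w(2) by (simp add: norm_rank_one mult.commute)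
  qed
qed

text \<open>This preorder is expressed by strong orthogonality alone, hence respected by every isomorphism.\<close>

definition strong_BJ_le :: "('h \<Rightarrow>\<^sub>L 'h) \<Rightarrow> ('h \<Rightarrow>\<^sub>L 'h) \<Rightarrow> bool" where
  "strong_BJ_le y' y \<longleftrightarrow> (\<forall>x\<in>\<AA>. strong_BJ \<AA> x y \<longrightarrow> strong_BJ \<AA> x y')"

text \<open>A right multiple \<open>y z0\<close> generates a smaller right ideal than \<open>y\<close>.\<close>

lemma strong_BJ_le_comp:
  assumes "block_diagonal \<Lambda> H z0"
  shows "strong_BJ_le (y o\<^sub>L z0) y"
proof -
  have "(y o\<^sub>L z0) o\<^sub>L z = y o\<^sub>L (z0 o\<^sub>L z)" for z :: "'h \<Rightarrow>\<^sub>L 'h"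
    by (rule blinfun_eqI) simp
  then show ?thesis
    unfolding strong_BJ_le_def strong_BJ_def by (simp add: compact_sum_comp[OF assms])
qed

text \<open>The operators \<open>u \<otimes> v\<^sup>*\<close> are right multiples of \<open>u \<otimes> w\<^sup>*\<close>. Conversely, testing against
  \<open>\<xi> \<otimes> \<xi>\<^sup>*\<close> with \<open>\<xi>\<close> orthogonal to \<open>u\<close> confines the range of anything below \<open>u \<otimes> w\<^sup>*\<close> to the
  line through \<open>u\<close>.\<close>

lemma strong_BJ_le_rank_one_iff:
  assumes l: "l \<in> \<Lambda>" and u: "u \<in> H l" "u \<noteq> 0" and w: "w \<in> H l" "w \<noteq> 0" and y: "y \<in> \<AA>"
  shows "strong_BJ_le y (rank_one u w) \<longleftrightarrow> (\<exists>v\<in>H l. y = rank_one u v)"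
proof
  assume "\<exists>v\<in>H l. y = rank_one u v"
  then obtain v where v: "v \<in> H l" "y = rank_one u v"
    by blast
  have "y = rank_one u w o\<^sub>L ((1 / cinner w w) *\<^sub>C rank_one w v)"
    using w(2) by (intro blinfun_eqI) (simp add: v(2) cinner_scaleC_left)
  moreover have "block_diagonal \<Lambda> H ((1 / cinner w w) *\<^sub>C rank_one w v)"
    by (intro compact_sum_block_diagonal compact_sum_scaleC rank_one_in_compact_sum[OF l] w v)
  ultimately show "strong_BJ_le y (rank_one u w)"
    using strong_BJ_le_comp by metis
next
  assume le: "strong_BJ_le y (rank_one u w)"
  note y' = compact_sum_block_diagonal[OF y]
  \<comment> \<open>The range of \<open>y\<close> is orthogonal to every block vector that is orthogonal to \<open>u\<close>.\<close>
  have range: "cinner (blinfun_apply y \<eta>) \<xi> = 0"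
    if "m \<in> \<Lambda>" "\<xi> \<in> H m" "\<eta> \<in> H m" "cinner u \<xi> = 0" for m \<xi> \<eta>
  proof (cases "\<xi> = 0")
    case False
    have "strong_BJ \<AA> (rank_one \<xi> \<xi>) (rank_one u w)"
      using that False
      by (subst strong_BJ_rank_one_iff[of m]) (auto simp: cinner_scaleC_left intro: rank_one_in_compact_sum[OF l u(1) w(1)])
    then have "strong_BJ \<AA> (rank_one \<xi> \<xi>) y"
      using le rank_one_in_compact_sum[OF that(1,2,2)] unfolding strong_BJ_le_def by blast
    then show ?thesis
      using strong_BJ_rank_one_iff[OF that(1,2) False that(2) False y] that(3) by blast
  qed simp
  obtain v where v: "v \<in> H l" "\<And>x. cinner (blinfun_apply y x) u = cinner x v"
    using block_adjoint_exists[OF y' l u(1)] by blast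
  have "y = rank_one u ((cnj (1 / cinner u u)) *\<^sub>C v)"
  proof (rule bounded_ops_eqI)
    show "y \<in> bounded_ops"
      using y' by (rule block_diagonal_bounded_ops)
    fix m x assume m: "m \<in> \<Lambda>" "x \<in> H m"
    show "blinfun_apply y x = blinfun_apply (rank_one u ((cnj (1 / cinner u u)) *\<^sub>C v)) x"
    proof (cases "m = l")
      case True
      define \<xi> where "\<xi> = blinfun_apply y x - (cinner (blinfun_apply y x) u / cinner u u) *\<^sub>C u"
      have "cinner \<xi> u = 0"
        unfolding \<xi>_def using u(2) by (rule cinner_orthogonal_component)
      moreover have "\<xi> \<in> H l"
        unfolding \<xi>_def using m True by (intro diff_in_H scaleC_in_H l u block_diagonal_in_H[OF y']) auto
      ultimately have "cinner (blinfun_apply y x) \<xi> = 0" "cinner u \<xi> = 0"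
        using range[OF l, of \<xi> x] m True cinner_eq_0_sym by auto
      then have "cinner \<xi> \<xi> = 0"
        by (subst (1) \<xi>_def) (simp add: cinner_diff_left cinner_scaleC_left)
      then have "\<xi> = 0"
        by simp
      then show ?thesis
        by (simp add: \<xi>_def v(2) cinner_scaleC_right)
    next
      case False
      have yx: "blinfun_apply y x \<in> H m"
        using m by (rule block_diagonal_in_H[OF y'])
      have "cinner u (blinfun_apply y x) = 0"
        using orthogonal_H[OF l m(1) False[symmetric] u(1) yx] .
      from range[OF m(1) yx m(2) this] have "blinfun_apply y x = 0"
        by simp
      moreover have "cinner x v = 0"
        using orthogonal_H[OF m(1) l False m(2) v(1)] .
      ultimately show ?thesis
        by (simp add: cinner_scaleC_right)
    qed
  qed (rule rank_one_bounded_ops)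
  then show "\<exists>v\<in>H l. y = rank_one u v"
    using scaleC_in_H[OF l v(1)] by blast
qed

definition is_rank_one :: "('h \<Rightarrow>\<^sub>L 'h) \<Rightarrow> bool" where
  "is_rank_one y \<longleftrightarrow> (\<exists>l\<in>\<Lambda>. \<exists>u\<in>H l. \<exists>v\<in>H l. u \<noteq> 0 \<and> v \<noteq> 0 \<and> y = rank_one u v)"

text \<open>Below any \<open>y\<close> that does not vanish at the block vector \<open>\<eta>\<close> lies \<open>y \<eta> \<otimes> \<eta>\<^sup>*\<close>, a right multiple
  of \<open>y\<close>. So a minimal \<open>y\<close> lies in turn below this operator, hence has rank one.\<close>

lemma is_rank_one_iff_minimal:
  assumes y: "y \<in> \<AA>"
  shows "is_rank_one y \<longleftrightarrow> y \<noteq> 0 \<and> (\<forall>y'\<in>\<AA>. y' \<noteq> 0 \<longrightarrow> strong_BJ_le y' y \<longrightarrow> strong_BJ_le y y')"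
proof
  assume "is_rank_one y"
  then obtain l u w where l: "l \<in> \<Lambda>" and u: "u \<in> H l" "u \<noteq> 0" and w: "w \<in> H l" "w \<noteq> 0"
    and y_eq: "y = rank_one u w"
    unfolding is_rank_one_def by blast
  have "strong_BJ_le y y'" if y': "y' \<in> \<AA>" "y' \<noteq> 0" "strong_BJ_le y' y" for y'
  proof -
    obtain v where v: "v \<in> H l" "y' = rank_one u v"
      using y'(3) unfolding y_eq strong_BJ_le_rank_one_iff[OF l u w y'(1)] by blast
    then have "v \<noteq> 0"
      using y'(2) by (auto simp: rank_one_eq_0_iff)
    then show ?thesis
      unfolding v(2) using strong_BJ_le_rank_one_iff[OF l u v(1) _ y] w(1) y_eq by blast
  qed
  moreover have "y \<noteq> 0"
    using u w y_eq by (simp add: rank_one_eq_0_iff)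
  ultimately show "y \<noteq> 0 \<and> (\<forall>y'\<in>\<AA>. y' \<noteq> 0 \<longrightarrow> strong_BJ_le y' y \<longrightarrow> strong_BJ_le y y')"
    by blast
next
  assume min: "y \<noteq> 0 \<and> (\<forall>y'\<in>\<AA>. y' \<noteq> 0 \<longrightarrow> strong_BJ_le y' y \<longrightarrow> strong_BJ_le y y')"
  note y' = compact_sum_block_diagonal[OF y]
  have "\<exists>l\<in>\<Lambda>. \<exists>\<eta>\<in>H l. blinfun_apply y \<eta> \<noteq> 0"
  proof (rule ccontr)
    assume "\<not> ?thesis"
    moreover have "0 \<in> bounded_ops"
      by (simp add: mem_bounded_ops_iff)
    ultimately have "y = 0"
      by (intro bounded_ops_eqI block_diagonal_bounded_ops[OF y']) auto
    then show False
      using min by blast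
  qed
  then obtain l \<eta> where l: "l \<in> \<Lambda>" and \<eta>: "\<eta> \<in> H l" and nz: "blinfun_apply y \<eta> \<noteq> 0"
    by blast
  have \<eta>0: "\<eta> \<noteq> 0"
    using nz by auto
  have y\<eta>: "blinfun_apply y \<eta> \<in> H l"
    using l \<eta> by (rule block_diagonal_in_H[OF y'])
  have "rank_one (blinfun_apply y \<eta>) \<eta> = y o\<^sub>L rank_one \<eta> \<eta>"
    by (rule blinfun_eqI) (simp add: block_diagonal_scaleC[OF y'])
  then have "strong_BJ_le (rank_one (blinfun_apply y \<eta>) \<eta>) y"
    using strong_BJ_le_comp[OF compact_sum_block_diagonal[OF rank_one_in_compact_sum[OF l \<eta> \<eta>]]] by metis
  moreover have "rank_one (blinfun_apply y \<eta>) \<eta> \<in> \<AA>" "rank_one (blinfun_apply y \<eta>) \<eta> \<noteq> 0"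
    using nz \<eta>0 by (auto simp: rank_one_eq_0_iff intro: rank_one_in_compact_sum[OF l] \<eta> y\<eta>)
  ultimately have "strong_BJ_le y (rank_one (blinfun_apply y \<eta>) \<eta>)"
    using min by blast
  then obtain v where v: "v \<in> H l" "y = rank_one (blinfun_apply y \<eta>) v"
    unfolding strong_BJ_le_rank_one_iff[OF l y\<eta> nz \<eta> \<eta>0 y] by blast
  moreover have "v \<noteq> 0"
    using min v(2) rank_one_eq_0_iff by metis
  ultimately show "is_rank_one y"
    unfolding is_rank_one_def using l y\<eta> nz by blast
qed

text \<open>The norm of the projection is attained at \<open>e\<close>, and right multiples of \<open>e' \<otimes> e'\<^sup>*\<close> do not change
  the \<open>e\<close>-component of the value there.\<close>

lemma strong_BJ_projection_sum:
  assumes e: "norm e = 1" "norm e' = 1" "cinner e e' = 0"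
  shows "strong_BJ \<AA> (rank_one e e + rank_one e' e') (rank_one e' e')"
  unfolding strong_BJ_def
proof
  fix z assume "z \<in> \<AA>"
  have e'e: "cinner e' e = 0"
    using e(3) by (rule cinner_eq_0_sym)
  let ?P = "rank_one e e + rank_one e' e'"
  have "norm ?P \<le> 1"
  proof (rule norm_blinfun_bound)
    fix x
    define y where "y = blinfun_apply ?P x"
    have y: "y = cinner x e *\<^sub>C e + cinner x e' *\<^sub>C e'"
      by (simp add: y_def blinfun.add_left)
    have "cinner y y = cinner x y"
      unfolding y cinner_simps using e e'e by (simp add: cinner_self mult.commute)
    moreover have "cmod (cinner y y) = (norm y)\<^sup>2"
      by (simp add: cinner_self norm_power)
    ultimately have "(norm y)\<^sup>2 \<le> norm x * norm y"
      using cmod_cinner_le[of x y] by simp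
    then show "norm y \<le> 1 * norm x"
      by (cases "y = 0") (simp_all add: power2_eq_square)
  qed simp
  also have "1 = cmod (cinner (blinfun_apply (?P + (rank_one e' e' o\<^sub>L z)) e) e)"
    using e e'e by (simp add: blinfun.add_left cinner_simps cinner_self)
  also have "\<dots> \<le> norm (blinfun_apply (?P + (rank_one e' e' o\<^sub>L z)) e)"
    using cmod_cinner_le[of _ e] e(1) by (metis mult.right_neutral)
  also have "\<dots> \<le> norm (?P + (rank_one e' e' o\<^sub>L z))"
    using norm_blinfun[of _ e] e(1) by (metis mult.right_neutral)
  finally show "norm ?P \<le> norm (?P + (rank_one e' e' o\<^sub>L z))" .
qed

text \<open>A right multiple of \<open>u' \<otimes> w'\<^sup>*\<close> cancels the second summand, so the hypothesis bounds the norm of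
  the sum by that of \<open>u \<otimes> w\<^sup>*\<close>. Evaluating the sum at \<open>w\<close> and at \<open>w'\<close> gives the two
  conclusions.\<close>

lemma orthogonal_if_strong_BJ_sum:
  assumes u: "u \<noteq> 0" "u' \<noteq> 0" "cinner u u' = 0"
    and w: "w \<noteq> 0" "w' \<noteq> 0" and m: "m \<in> \<Lambda>" "w' \<in> H m"
    and BJ: "strong_BJ \<AA> (rank_one u w + rank_one u' w') (rank_one u' w')"
  shows "cinner w w' = 0" "norm u' * norm w' \<le> norm u * norm w"
proof -
  let ?Y = "rank_one u w + rank_one u' w'"
  \<comment> \<open>Minus the projection onto the line through \<open>w'\<close>.\<close>
  define z where "z = (- (1 / cinner w' w')) *\<^sub>C rank_one w' w'"
  have "z \<in> \<AA>"
    unfolding z_def using m by (intro compact_sum_scaleC rank_one_in_compact_sum)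
  moreover have "?Y + (rank_one u' w' o\<^sub>L z) = rank_one u w"
    using w by (intro blinfun_eqI) (simp add: z_def blinfun.add_left blinfun.minus_left cinner_simps)
  ultimately have Y: "norm ?Y \<le> norm u * norm w"
    using BJ unfolding strong_BJ_def by (metis norm_rank_one)
  have bound: "norm (blinfun_apply ?Y x) \<le> norm u * norm w * norm x" for x
    using norm_blinfun[of ?Y x] mult_right_mono[OF Y, of "norm x"] by simp
  have "cinner (cinner w w *\<^sub>C u) (cinner w w' *\<^sub>C u') = 0"
    using u(3) by (simp add: cinner_simps)
  from norm_add_orthogonal_sq[OF this]
  have "(norm (blinfun_apply ?Y w))\<^sup>2 = (norm w * norm w * norm u)\<^sup>2 + (cmod (cinner w w') * norm u')\<^sup>2"
    by (simp add: blinfun.add_left norm_scaleC cinner_self norm_mult norm_power flip: power2_eq_square)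
  moreover have "(norm (blinfun_apply ?Y w))\<^sup>2 \<le> (norm w * norm w * norm u)\<^sup>2"
    using bound[of w] by (intro power_mono) (simp_all add: mult_ac)
  ultimately have "(cmod (cinner w w') * norm u')\<^sup>2 \<le> 0"
    by linarith
  then show ww': "cinner w w' = 0"
    using u(2) by simp
  have "norm w' * norm w' * norm u' \<le> norm u * norm w * norm w'"
    using bound[of w'] cinner_eq_0_sym[OF ww']
    by (simp add: blinfun.add_left norm_scaleC cinner_self norm_mult power2_eq_square)
  then show "norm u' * norm w' \<le> norm u * norm w"
    using w(2) by (simp add: mult_ac)
qed

end

section \<open>The action of a linear strong orthogonality isomorphism on rank-one operators\<close>

locale linear_strong_BJ_isomorphism = hilbert_decomposition \<Lambda> H
  for \<Lambda> :: "'l set" and H :: "'l \<Rightarrow> 'h::chilbert_space set" +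
  fixes \<Phi> :: "('h \<Rightarrow>\<^sub>L 'h) \<Rightarrow> ('h \<Rightarrow>\<^sub>L 'h)"
  assumes nontrivial: "\<And>l. l \<in> \<Lambda> \<Longrightarrow> H l \<noteq> {0}"
    and linear: "complex_linear_on \<AA> \<Phi>"
    and isomorphism: "strong_BJ_isomorphism \<AA> \<Phi>"
begin

lemma bij: "bij_betw \<Phi> \<AA> \<AA>"
  and strong_BJ_iff: "x \<in> \<AA> \<Longrightarrow> y \<in> \<AA> \<Longrightarrow> strong_BJ \<AA> (\<Phi> x) (\<Phi> y) \<longleftrightarrow> strong_BJ \<AA> x y"
  using isomorphism by (auto simp: strong_BJ_isomorphism_def)

lemma add: "x \<in> \<AA> \<Longrightarrow> y \<in> \<AA> \<Longrightarrow> \<Phi> (x + y) = \<Phi> x + \<Phi> y"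
  and scaleC: "x \<in> \<AA> \<Longrightarrow> \<Phi> (c *\<^sub>C x) = c *\<^sub>C \<Phi> x"
  using linear by (auto simp: complex_linear_on_def)

lemma mem: "x \<in> \<AA> \<Longrightarrow> \<Phi> x \<in> \<AA>"
  using bij by (auto simp: bij_betw_def)

lemma inj: "x \<in> \<AA> \<Longrightarrow> y \<in> \<AA> \<Longrightarrow> \<Phi> x = \<Phi> y \<Longrightarrow> x = y"
  using bij by (auto simp: bij_betw_def inj_on_def)

lemma diff: "x \<in> \<AA> \<Longrightarrow> y \<in> \<AA> \<Longrightarrow> \<Phi> (x - y) = \<Phi> x - \<Phi> y"
  using add[of "x - y" y] compact_sum_diff by simp

lemma eq_0_iff: "x \<in> \<AA> \<Longrightarrow> \<Phi> x = 0 \<longleftrightarrow> x = 0"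
proof -
  assume x: "x \<in> \<AA>"
  have "0 \<in> \<AA>" "\<Phi> 0 = 0"
    using compact_sum_scaleC[OF x, of 0] scaleC[OF x, of 0] by simp_all
  then show "\<Phi> x = 0 \<longleftrightarrow> x = 0"
    using inj[OF x, of 0] by auto
qed

lemma inverse: "linear_strong_BJ_isomorphism \<Lambda> H (inv_into \<AA> \<Phi>)"
proof unfold_locales
  let ?\<Psi> = "inv_into \<AA> \<Phi>"
  have \<Psi>: "?\<Psi> x \<in> \<AA>" "\<Phi> (?\<Psi> x) = x" if "x \<in> \<AA>" for x
    using bij that by (auto simp: bij_betw_def inv_into_into f_inv_into_f)
  have \<Psi>_eqI: "?\<Psi> y = x" if "x \<in> \<AA>" "\<Phi> x = y" for x y
    using bij that by (auto simp: bij_betw_def inv_into_f_eq)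
  show "complex_linear_on \<AA> ?\<Psi>"
    unfolding complex_linear_on_def
    by (auto intro!: \<Psi>_eqI compact_sum_add compact_sum_scaleC simp: \<Psi> add scaleC)
  show "strong_BJ_isomorphism \<AA> ?\<Psi>"
    unfolding strong_BJ_isomorphism_def
    using bij_betw_inv_into[OF bij] strong_BJ_iff \<Psi> by metis
qed (use nontrivial in auto)

lemma strong_BJ_le_iff:
  assumes "y \<in> \<AA>" "y' \<in> \<AA>"
  shows "strong_BJ_le (\<Phi> y') (\<Phi> y) \<longleftrightarrow> strong_BJ_le y' y"
proof -
  have "(\<forall>x\<in>\<AA>. P x) \<longleftrightarrow> (\<forall>x\<in>\<AA>. P (\<Phi> x))" for P
    using bij by (metis bij_betw_def imageE imageI)
  from this[of "\<lambda>x. strong_BJ \<AA> x (\<Phi> y) \<longrightarrow> strong_BJ \<AA> x (\<Phi> y')"] show ?thesis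
    unfolding strong_BJ_le_def using strong_BJ_iff assms by auto
qed

lemma is_rank_one_image:
  assumes y: "y \<in> \<AA>" "is_rank_one y"
  shows "is_rank_one (\<Phi> y)"
proof -
  have min: "y \<noteq> 0" "\<And>y'. y' \<in> \<AA> \<Longrightarrow> y' \<noteq> 0 \<Longrightarrow> strong_BJ_le y' y \<Longrightarrow> strong_BJ_le y y'"
    using y(2) unfolding is_rank_one_iff_minimal[OF y(1)] by blast+
  have "strong_BJ_le (\<Phi> y) z" if z: "z \<in> \<AA>" "z \<noteq> 0" "strong_BJ_le z (\<Phi> y)" for z
  proof -
    obtain y' where y': "y' \<in> \<AA>" "z = \<Phi> y'"
      using bij z(1) by (auto simp: bij_betw_def)
    then show ?thesis
      using z(2,3) min(2)[OF y'(1)] strong_BJ_le_iff y(1) eq_0_iff by auto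
  qed
  then show ?thesis
    unfolding is_rank_one_iff_minimal[OF mem[OF y(1)]] using min(1) eq_0_iff[OF y(1)] by blast
qed

text \<open>A row \<open>{u \<otimes> v\<^sup>* | v}\<close> is the set of all elements below any of its nonzero members.\<close>

lemma row_image:
  assumes l: "l \<in> \<Lambda>" and u: "u \<in> H l" "u \<noteq> 0"
  obtains m u' C where "m \<in> \<Lambda>" "u' \<in> H m" "u' \<noteq> 0"
    "\<And>v. v \<in> H l \<Longrightarrow> C v \<in> H m" "\<And>v. v \<in> H l \<Longrightarrow> \<Phi> (rank_one u v) = rank_one u' (C v)"
proof -
  have uu: "rank_one u u \<in> \<AA>"
    by (intro rank_one_in_compact_sum[OF l] u)
  have "is_rank_one (rank_one u u)"
    unfolding is_rank_one_def using l u by blast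
  from is_rank_one_image[OF uu this]
  obtain m u' w where m: "m \<in> \<Lambda>" and u': "u' \<in> H m" "u' \<noteq> 0" and w: "w \<in> H m" "w \<noteq> 0"
    and eq: "\<Phi> (rank_one u u) = rank_one u' w"
    unfolding is_rank_one_def by blast
  have "\<exists>v'. v' \<in> H m \<and> \<Phi> (rank_one u v) = rank_one u' v'" if "v \<in> H l" for v
  proof -
    have uv: "rank_one u v \<in> \<AA>"
      by (intro rank_one_in_compact_sum[OF l] u that)
    have "strong_BJ_le (rank_one u v) (rank_one u u)"
      unfolding strong_BJ_le_rank_one_iff[OF l u u uv] using that by blast
    then have "strong_BJ_le (\<Phi> (rank_one u v)) (rank_one u' w)"
      using strong_BJ_le_iff[OF uu uv] eq by simp
    then show ?thesis
      unfolding strong_BJ_le_rank_one_iff[OF m u' w mem[OF uv]] by blast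
  qed
  then obtain C where "\<And>v. v \<in> H l \<Longrightarrow> C v \<in> H m \<and> \<Phi> (rank_one u v) = rank_one u' (C v)"
    by metis
  with that m u' show ?thesis
    by blast
qed

text \<open>Different rows have different images, since comparability is reflected by \<open>\<Phi>\<close>.\<close>

lemma left_factors_dependent_if_images_share:
  assumes l: "l \<in> \<Lambda>" and u: "u \<in> H l" "u \<noteq> 0" and v: "v \<in> H l" "v \<noteq> 0"
    and l': "l' \<in> \<Lambda>" and u': "u' \<in> H l'" "u' \<noteq> 0" and v': "v' \<in> H l'" "v' \<noteq> 0"
    and m: "m \<in> \<Lambda>" and a: "a \<in> H m" "a \<noteq> 0"
    and eq: "\<Phi> (rank_one u v) = rank_one a b" "b \<in> H m"
    and eq': "\<Phi> (rank_one u' v') = rank_one a b'" "b' \<in> H m"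
  shows "\<exists>c. u = c *\<^sub>C u'"
proof -
  have uv: "rank_one u v \<in> \<AA>" and uv': "rank_one u' v' \<in> \<AA>"
    using rank_one_in_compact_sum[OF l u(1) v(1)] rank_one_in_compact_sum[OF l' u'(1) v'(1)] by blast+
  have b0: "b' \<noteq> 0"
    using eq_0_iff[OF uv'] u' v' eq'(1) by (auto simp: rank_one_eq_0_iff)
  have "strong_BJ_le (\<Phi> (rank_one u v)) (\<Phi> (rank_one u' v'))"
    using strong_BJ_le_rank_one_iff[OF m a eq'(2) b0 mem[OF uv]] eq eq'(1) by auto
  then have "strong_BJ_le (rank_one u v) (rank_one u' v')"
    using strong_BJ_le_iff uv uv' by blast
  then obtain w where w: "rank_one u v = rank_one u' w"
    unfolding strong_BJ_le_rank_one_iff[OF l' u' v' uv] by blast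
  then show ?thesis
    using rank_one_eqD(1)[OF w[symmetric] u(2) v(2)] by blast
qed

text \<open>The values of \<open>D\<close> and \<open>C\<close> outside \<open>H l\<close> are left arbitrary.\<close>

definition block_form :: "'l \<Rightarrow> 'l \<Rightarrow> ('h \<Rightarrow> 'h) \<Rightarrow> ('h \<Rightarrow> 'h) \<Rightarrow> bool" where
  "block_form l m D C \<longleftrightarrow> l \<in> \<Lambda> \<and> m \<in> \<Lambda> \<and> D ` H l \<subseteq> H m \<and> C ` H l \<subseteq> H m \<and>
     (\<forall>u\<in>H l. \<forall>v\<in>H l. \<Phi> (rank_one u v) = rank_one (D u) (C v))"

text \<open>The map \<open>C\<close> is read off from the row of one fixed vector \<open>e\<close>. For \<open>u\<close> independent of \<open>e\<close>, the
  image of the row of \<open>u + e\<close> is a single row again, so \<open>u1 \<otimes> (C1 v)\<^sup>* + e' \<otimes> (C v)\<^sup>*\<close> has its range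
  in one fixed line for all \<open>v\<close>. Because \<open>u1\<close> and \<open>e'\<close> are independent, \<open>C1\<close> must be a scalar
  multiple of \<open>C\<close>; the scalar moves to the left factor and becomes part of \<open>D u\<close>.\<close>

lemma block_form_exists:
  assumes l: "l \<in> \<Lambda>"
  obtains m D C where "block_form l m D C"
proof -
  obtain e where e: "e \<in> H l" "e \<noteq> 0"
    using nontrivial[OF l] zero_in_H[OF l] by blast
  obtain m e' C where m: "m \<in> \<Lambda>" and e': "e' \<in> H m" "e' \<noteq> 0"
    and C: "\<And>v. v \<in> H l \<Longrightarrow> C v \<in> H m"
    and \<Phi>e: "\<And>v. v \<in> H l \<Longrightarrow> \<Phi> (rank_one e v) = rank_one e' (C v)"
    using row_image[OF l e] by blast
  have Ce: "C e \<noteq> 0"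
    using eq_0_iff[OF rank_one_in_compact_sum[OF l e(1) e(1)]] \<Phi>e[OF e(1)] e
    by (auto simp: rank_one_eq_0_iff)
  have "\<exists>d\<in>H m. \<forall>v\<in>H l. \<Phi> (rank_one u v) = rank_one d (C v)" if u: "u \<in> H l" for u
  proof (cases "\<exists>c. u = c *\<^sub>C e")
    case True
    then obtain c where "u = c *\<^sub>C e" ..
    then show ?thesis
      using scaleC_in_H[OF m e'(1)] l e(1)
      by (intro bexI[of _ "c *\<^sub>C e'"]) (simp_all add: rank_one_scaleC_left scaleC rank_one_in_compact_sum \<Phi>e)
  next
    case False
    have u0: "u \<noteq> 0"
      using False[simplified, rule_format, of 0] by simp
    have "u + e \<noteq> 0"
      using False[simplified, rule_format, of "- 1"] by (auto simp: scaleC_minus_one add_eq_0_iff2)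
    obtain m1 u1 C1 where m1: "m1 \<in> \<Lambda>" and u1: "u1 \<in> H m1" "u1 \<noteq> 0"
      and C1: "\<And>v. v \<in> H l \<Longrightarrow> C1 v \<in> H m1"
      and \<Phi>u: "\<And>v. v \<in> H l \<Longrightarrow> \<Phi> (rank_one u v) = rank_one u1 (C1 v)"
      using row_image[OF l u u0] by blast
    obtain m2 u2 C2 where \<Phi>ue: "\<And>v. v \<in> H l \<Longrightarrow> \<Phi> (rank_one (u + e) v) = rank_one u2 (C2 v)"
      using row_image[OF l add_in_H[OF l u e(1)] \<open>u + e \<noteq> 0\<close>] by metis
    have C1e: "C1 e \<noteq> 0"
      using eq_0_iff[OF rank_one_in_compact_sum[OF l u e(1)]] \<Phi>u[OF e(1)] e u0
      by (auto simp: rank_one_eq_0_iff)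
    have not_multiple: "u1 \<noteq> c *\<^sub>C e'" for c
    proof
      assume c: "u1 = c *\<^sub>C e'"
      have "u1 \<in> H m"
        unfolding c by (rule scaleC_in_H[OF m e'(1)])
      then have "m1 = m"
        using block_unique m1 m u1 by blast
      then have "cnj c *\<^sub>C C1 e \<in> H m"
        using scaleC_in_H[OF m] C1[OF e(1)] by blast
      moreover have "\<Phi> (rank_one u e) = rank_one e' (cnj c *\<^sub>C C1 e)"
        using \<Phi>u[OF e(1)] c by (simp add: rank_one_scaleC_left rank_one_scaleC_right)
      ultimately have "\<exists>c. u = c *\<^sub>C e"
        using left_factors_dependent_if_images_share[OF l u u0 e l e e m e' _ _ \<Phi>e[OF e(1)] C[OF e(1)]]
        by blast
      then show False
        using False by blast
    qed
    have indep: "a = 0 \<and> b = 0" if "a *\<^sub>C u1 + b *\<^sub>C e' = 0" for a b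
    proof -
      have "a = 0"
      proof (rule ccontr)
        assume "a \<noteq> 0"
        have "a *\<^sub>C u1 = (- b) *\<^sub>C e'"
          using that by (simp add: eq_neg_iff_add_eq_0)
        then have "(1 / a) *\<^sub>C (a *\<^sub>C u1) = (1 / a) *\<^sub>C ((- b) *\<^sub>C e')"
          by (rule arg_cong)
        then have "u1 = (- b / a) *\<^sub>C e'"
          using \<open>a \<noteq> 0\<close> by (simp add: scaleC_scaleC scaleC_one)
        with not_multiple show False
          by blast
      qed
      then show ?thesis
        using that e'(2) by simp
    qed
    have sum: "cinner x (C1 v) *\<^sub>C u1 + cinner x (C v) *\<^sub>C e' = cinner x (C2 v) *\<^sub>C u2" if v: "v \<in> H l" for x v
    proof -
      have "\<Phi> (rank_one (u + e) v) = \<Phi> (rank_one u v) + \<Phi> (rank_one e v)"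
        unfolding rank_one_add_left by (intro add rank_one_in_compact_sum[OF l] u e v)
      then have "rank_one u2 (C2 v) = rank_one u1 (C1 v) + rank_one e' (C v)"
        using v by (simp add: \<Phi>ue \<Phi>u \<Phi>e)
      from arg_cong[OF this, of "\<lambda>A. blinfun_apply A x"] show ?thesis
        by (simp add: blinfun.add_left)
    qed
    define a b k where "a = cinner (C e) (C1 e)" and "b = cinner (C e) (C e)" and "k = cinner (C e) (C2 e)"
    have abk: "a *\<^sub>C u1 + b *\<^sub>C e' = k *\<^sub>C u2"
      using sum[OF e(1), of "C e"] by (simp add: a_def b_def k_def)
    have b: "b \<noteq> 0"
      using Ce by (simp add: b_def)
    have k: "k \<noteq> 0"
      using abk indep[of a b] b by auto
    have C1_eq: "C1 v = cnj (a / b) *\<^sub>C C v" if v: "v \<in> H l" for v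
    proof -
      have "cinner x (C1 v) = (a / b) * cinner x (C v)" for x
      proof -
        define s where "s = cinner x (C2 v)"
        have "k *\<^sub>C (cinner x (C1 v) *\<^sub>C u1 + cinner x (C v) *\<^sub>C e') = s *\<^sub>C (k *\<^sub>C u2)"
          unfolding sum[OF v] by (simp add: scaleC_scaleC s_def mult.commute)
        also have "\<dots> = s *\<^sub>C (a *\<^sub>C u1 + b *\<^sub>C e')"
          by (simp only: abk)
        finally have "(k * cinner x (C1 v) - s * a) *\<^sub>C u1 + (k * cinner x (C v) - s * b) *\<^sub>C e' = 0"
          by (simp add: scaleC_add_right scaleC_scaleC complex_vector.scale_left_diff_distrib algebra_simps)
        then have "k * cinner x (C1 v) = s * a" "k * cinner x (C v) = s * b"
          using indep by force+
        then have "k * (b * cinner x (C1 v)) = k * (a * cinner x (C v))"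
          by (metis mult.commute mult.left_commute)
        then show ?thesis
          using k b by (simp add: field_simps)
      qed
      then have "cinner (C1 v - cnj (a / b) *\<^sub>C C v) (C1 v - cnj (a / b) *\<^sub>C C v) = 0"
        unfolding cinner_diff_right cinner_scaleC_right by simp
      then show ?thesis
        unfolding cinner_self_eq_0 by simp
    qed
    have "C1 e \<in> H m"
      unfolding C1_eq[OF e(1)] by (intro scaleC_in_H m C e)
    then have "m1 = m"
      using block_unique[OF m1 m C1[OF e(1)]] C1e by blast
    then have "(a / b) *\<^sub>C u1 \<in> H m"
      using u1 m1 by (auto intro: scaleC_in_H)
    moreover have "\<Phi> (rank_one u v) = rank_one ((a / b) *\<^sub>C u1) (C v)" if "v \<in> H l" for v
      using that by (simp add: \<Phi>u C1_eq rank_one_scaleC_left rank_one_scaleC_right)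
    ultimately show ?thesis
      by blast
  qed
  then obtain D where "\<And>u. u \<in> H l \<Longrightarrow> D u \<in> H m \<and> (\<forall>v\<in>H l. \<Phi> (rank_one u v) = rank_one (D u) (C v))"
    by metis
  then have "block_form l m D C"
    unfolding block_form_def using l m C by blast
  then show ?thesis
    using that by blast
qed

lemma block_formD:
  assumes "block_form l m D C"
  shows "l \<in> \<Lambda>" "m \<in> \<Lambda>" "\<And>u. u \<in> H l \<Longrightarrow> D u \<in> H m" "\<And>u. u \<in> H l \<Longrightarrow> C u \<in> H m"
    "\<And>u v. u \<in> H l \<Longrightarrow> v \<in> H l \<Longrightarrow> \<Phi> (rank_one u v) = rank_one (D u) (C v)"
  using assms unfolding block_form_def by blast+

lemma block_form_nonzero:
  assumes B: "block_form l m D C" and u: "u \<in> H l" "u \<noteq> 0"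
  shows "D u \<noteq> 0" "C u \<noteq> 0"
  using eq_0_iff[OF rank_one_in_compact_sum[OF block_formD(1)[OF B] u(1) u(1)]]
    block_formD(5)[OF B u(1) u(1)] u by (auto simp: rank_one_eq_0_iff)

lemma block_form_add:
  assumes B: "block_form l m D C" and u: "u \<in> H l" and v: "v \<in> H l"
  shows "D (u + v) = D u + D v" "C (u + v) = C u + C v"
proof -
  note l = block_formD(1)[OF B] and \<Phi> = block_formD(5)[OF B]
  note in_H = u v add_in_H[OF l u v]
  obtain e where e: "e \<in> H l" "e \<noteq> 0"
    using nontrivial[OF l] zero_in_H[OF l] by blast
  note nz = block_form_nonzero[OF B e]
  have A: "x \<in> H l \<Longrightarrow> y \<in> H l \<Longrightarrow> rank_one x y \<in> \<AA>" for x y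
    by (rule rank_one_in_compact_sum[OF l])
  have "rank_one (D (u + v)) (C e) = rank_one (D u + D v) (C e)"
    using add[of "rank_one u e" "rank_one v e"] by (simp add: rank_one_add_left[symmetric] A in_H e \<Phi>)
  then show "D (u + v) = D u + D v"
    using nz by (blast dest: rank_one_cancel_right)
  have "rank_one (D e) (C (u + v)) = rank_one (D e) (C u + C v)"
    using add[of "rank_one e u" "rank_one e v"] by (simp add: rank_one_add_right[symmetric] A in_H e \<Phi>)
  then show "C (u + v) = C u + C v"
    using nz by (blast dest: rank_one_cancel_left)
qed

lemma block_form_scaleC:
  assumes B: "block_form l m D C" and u: "u \<in> H l"
  shows "D (c *\<^sub>C u) = c *\<^sub>C D u" "C (c *\<^sub>C u) = c *\<^sub>C C u"
proof -
  note l = block_formD(1)[OF B] and \<Phi> = block_formD(5)[OF B]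
  note in_H = u scaleC_in_H[OF l u]
  obtain e where e: "e \<in> H l" "e \<noteq> 0"
    using nontrivial[OF l] zero_in_H[OF l] by blast
  note nz = block_form_nonzero[OF B e]
  have A: "x \<in> H l \<Longrightarrow> y \<in> H l \<Longrightarrow> rank_one x y \<in> \<AA>" for x y
    by (rule rank_one_in_compact_sum[OF l])
  have "rank_one (D (c *\<^sub>C u)) (C e) = rank_one (c *\<^sub>C D u) (C e)"
    using scaleC[of "rank_one u e" c] by (simp add: rank_one_scaleC_left[symmetric] A in_H e \<Phi>)
  then show "D (c *\<^sub>C u) = c *\<^sub>C D u"
    using nz by (blast dest: rank_one_cancel_right)
  have "rank_one (D e) (C (c *\<^sub>C u)) = rank_one (D e) (c *\<^sub>C C u)"
    using scaleC[of "rank_one e u" "cnj c"] rank_one_scaleC_right[of e c u] rank_one_scaleC_right[of "D e" c "C u"]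
    by (simp add: A in_H e \<Phi> flip: \<Phi>)
  then show "C (c *\<^sub>C u) = c *\<^sub>C C u"
    using nz by (blast dest: rank_one_cancel_left)
qed

lemma block_form_zero:
  assumes B: "block_form l m D C"
  shows "D 0 = 0" "C 0 = 0"
  using block_form_scaleC[OF B zero_in_H[OF block_formD(1)[OF B]], of 0] by simp_all

lemma block_form_target_unique:
  assumes B: "block_form l m D C" and uv: "u \<in> H l" "v \<in> H l"
    and n: "n \<in> \<Lambda>" "a \<in> H n" "a \<noteq> 0" "b \<noteq> 0" and eq: "\<Phi> (rank_one u v) = rank_one a b"
  shows "m = n" "\<exists>c. a = D (c *\<^sub>C u)" "\<exists>c. b = C (c *\<^sub>C v)"
proof -
  have eq': "rank_one (D u) (C v) = rank_one a b"
    using eq block_formD(5)[OF B uv] by simp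
  obtain c where c: "a = c *\<^sub>C D u"
    using rank_one_eqD(1)[OF eq' n(3,4)] by blast
  obtain c' where c': "b = c' *\<^sub>C C v"
    using rank_one_eqD(2)[OF eq' n(3,4)] by blast
  have "a \<in> H m"
    unfolding c by (intro scaleC_in_H block_formD[OF B] uv)
  then show "m = n"
    using block_unique block_formD(2)[OF B] n by blast
  show "\<exists>c. a = D (c *\<^sub>C u)" "\<exists>c. b = C (c *\<^sub>C v)"
    using c c' block_form_scaleC[OF B] uv by metis+
qed

text \<open>The inverse of \<open>\<Phi>\<close> is an isomorphism as well and has a block form on \<open>H m\<close>, whose target block
  must be the source of every block form with target \<open>m\<close>.\<close>

lemma block_form_source_unique:
  assumes B: "block_form l m D C" and B': "block_form l' m D' C'"
  shows "l = l'"
proof -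
  interpret inv: linear_strong_BJ_isomorphism \<Lambda> H "inv_into \<AA> \<Phi>"
    by (rule inverse)
  obtain k E F where inv: "inv.block_form m k E F"
    using inv.block_form_exists[OF block_formD(2)[OF B]] by blast
  have "k = j" if J: "block_form j m G K" for j G K
  proof -
    note JD = block_formD[OF J]
    obtain e where e: "e \<in> H j" "e \<noteq> 0"
      using nontrivial[OF JD(1)] zero_in_H[OF JD(1)] by blast
    have "inv_into \<AA> \<Phi> (rank_one (G e) (K e)) = rank_one e e"
      using JD(5)[OF e(1) e(1)] bij rank_one_in_compact_sum[OF JD(1) e(1) e(1)]
      by (metis bij_betw_def inv_into_f_f)
    then show "k = j"
      by (rule inv.block_form_target_unique(1)[OF inv JD(3,4)[OF e(1)] JD(1) e(1) e(2) e(2)])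
  qed
  then show ?thesis
    using B B' by blast
qed

lemma rank_one_preimage:
  assumes m: "m \<in> \<Lambda>" and a: "a \<in> H m" "a \<noteq> 0"
  obtains l u v where "l \<in> \<Lambda>" "u \<in> H l" "v \<in> H l" "\<Phi> (rank_one u v) = rank_one a a"
proof -
  interpret inv: linear_strong_BJ_isomorphism \<Lambda> H "inv_into \<AA> \<Phi>"
    by (rule inverse)
  have aa: "rank_one a a \<in> \<AA>"
    by (rule rank_one_in_compact_sum[OF m a(1) a(1)])
  have "is_rank_one (rank_one a a)"
    unfolding is_rank_one_def using m a by blast
  from inv.is_rank_one_image[OF aa this]
  obtain l u v where l: "l \<in> \<Lambda>" "u \<in> H l" "v \<in> H l" "inv_into \<AA> \<Phi> (rank_one a a) = rank_one u v"
    unfolding is_rank_one_def by blast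
  moreover have "\<Phi> (inv_into \<AA> \<Phi> (rank_one a a)) = rank_one a a"
    using bij aa by (metis bij_betw_def f_inv_into_f)
  ultimately show ?thesis
    using that by metis
qed

lemma block_form_surj:
  assumes B: "block_form l m D C"
  shows "D ` H l = H m" "C ` H l = H m"
proof -
  note BD = block_formD[OF B]
  have "a \<in> D ` H l \<and> a \<in> C ` H l" if a: "a \<in> H m" for a
  proof (cases "a = 0")
    case True
    then show ?thesis
      using block_form_zero[OF B] zero_in_H[OF BD(1)] by (metis imageI)
  next
    case False
    obtain k u v where k: "k \<in> \<Lambda>" "u \<in> H k" "v \<in> H k" "\<Phi> (rank_one u v) = rank_one a a"
      using rank_one_preimage[OF BD(2) a False] by blast
    obtain n E F where E: "block_form k n E F"
      using block_form_exists[OF k(1)] by blast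
    have "n = m"
      by (rule block_form_target_unique(1)[OF E k(2,3) BD(2) a False False k(4)])
    then have "k = l"
      using block_form_source_unique E B by blast
    then have uv: "u \<in> H l" "v \<in> H l"
      using k by auto
    from block_form_target_unique(2,3)[OF B uv BD(2) a False False k(4)]
    show ?thesis
      using uv scaleC_in_H[OF BD(1)] by (metis imageI)
  qed
  then show "D ` H l = H m" "C ` H l = H m"
    using BD(3,4) by blast+
qed

text \<open>For rank-one operators strong orthogonality is orthogonality of the left factors.\<close>

lemma block_form_left_orthogonal:
  assumes B: "block_form l m D C" and B': "block_form l' m' D' C'"
    and u: "u \<in> H l" "u' \<in> H l'" "cinner u u' = 0"
  shows "cinner (D u) (D' u') = 0"
proof (cases "u = 0 \<or> u' = 0 \<or> m \<noteq> m'")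
  case True
  then show ?thesis
    using block_form_zero[OF B] block_form_zero[OF B'] orthogonal_H block_formD[OF B] block_formD[OF B'] u by auto
next
  case False
  then have nz: "u \<noteq> 0" "u' \<noteq> 0" and m: "m' = m"
    by auto
  note BD = block_formD[OF B] and B'D = block_formD[OF B'] and Bn = block_form_nonzero[OF B u(1) nz(1)]
    and B'n = block_form_nonzero[OF B' u(2) nz(2)]
  have mem: "rank_one u u \<in> \<AA>" "rank_one u' u' \<in> \<AA>"
    using rank_one_in_compact_sum BD(1) B'D(1) u by blast+
  have "strong_BJ \<AA> (rank_one u u) (rank_one u' u')"
    using cinner_eq_0_sym[OF u(3)]
    by (simp add: strong_BJ_rank_one_iff[OF BD(1) u(1) nz(1) u(1) nz(1) mem(2)] cinner_scaleC_left)
  then have "strong_BJ \<AA> (rank_one (D u) (C u)) (rank_one (D' u') (C' u'))"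
    using strong_BJ_iff[OF mem] BD(5) B'D(5) u by simp
  then have "\<forall>\<eta>\<in>H m. cinner (blinfun_apply (rank_one (D' u') (C' u')) \<eta>) (D u) = 0"
    using strong_BJ_rank_one_iff[OF BD(2) BD(3)[OF u(1)] Bn(1) BD(4)[OF u(1)] Bn(2),
        of "rank_one (D' u') (C' u')"] rank_one_in_compact_sum[OF B'D(2) B'D(3,4)[OF u(2)]] by blast
  moreover have "C' u' \<in> H m"
    using B'D(4)[OF u(2)] m by simp
  ultimately have "cinner (C' u') (C' u') * cinner (D' u') (D u) = 0"
    unfolding rank_one_apply cinner_scaleC_left by blast
  then show ?thesis
    using B'n cinner_eq_0_sym by auto
qed

text \<open>The image of \<open>e \<otimes> e\<^sup>* + e' \<otimes> e'\<^sup>*\<close> is \<open>D e \<otimes> (C e)\<^sup>* + D' e' \<otimes> (C' e')\<^sup>*\<close>, and its left factors are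
  already known to be orthogonal. The two vectors may lie in the same block or in different ones.\<close>

lemma block_form_right_orthogonal:
  assumes B: "block_form l m D C" and B': "block_form l' m' D' C'"
    and e: "e \<in> H l" "e' \<in> H l'" "norm e = 1" "norm e' = 1" "cinner e e' = 0"
  shows "cinner (C e) (C' e') = 0" "norm (D' e') * norm (C' e') \<le> norm (D e) * norm (C e)"
proof -
  note BD = block_formD[OF B] and B'D = block_formD[OF B']
  have nz: "e \<noteq> 0" "e' \<noteq> 0"
    using e(3,4) by auto
  note Bn = block_form_nonzero[OF B e(1) nz(1)] and B'n = block_form_nonzero[OF B' e(2) nz(2)]
  have mem: "rank_one e e \<in> \<AA>" "rank_one e' e' \<in> \<AA>"
    using rank_one_in_compact_sum BD(1) B'D(1) e by blast+
  have "strong_BJ \<AA> (\<Phi> (rank_one e e + rank_one e' e')) (\<Phi> (rank_one e' e'))"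
    using strong_BJ_iff[OF compact_sum_add[OF mem] mem(2)] strong_BJ_projection_sum[OF e(3,4,5)] by blast
  then have BJ: "strong_BJ \<AA> (rank_one (D e) (C e) + rank_one (D' e') (C' e')) (rank_one (D' e') (C' e'))"
    using add[OF mem] BD(5) B'D(5) e by simp
  have orth: "cinner (D e) (D' e') = 0"
    using block_form_left_orthogonal[OF B B'] e by blast
  show "cinner (C e) (C' e') = 0" "norm (D' e') * norm (C' e') \<le> norm (D e) * norm (C e)"
    using orthogonal_if_strong_BJ_sum[OF Bn(1) B'n(1) orth Bn(2) B'n(2) B'D(2) B'D(4)[OF e(2)] BJ] by blast+
qed

definition unit_vector :: "'l \<Rightarrow> 'h" where
  "unit_vector l = (SOME e. e \<in> H l \<and> norm e = 1)"

lemma unit_vector: "l \<in> \<Lambda> \<Longrightarrow> unit_vector l \<in> H l" "l \<in> \<Lambda> \<Longrightarrow> norm (unit_vector l) = 1"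
proof -
  have "\<exists>e. e \<in> H l \<and> norm e = 1" if l: "l \<in> \<Lambda>"
  proof -
    obtain e where e: "e \<in> H l" "e \<noteq> 0"
      using nontrivial[OF l] zero_in_H[OF l] by blast
    then show ?thesis
      by (intro exI[of _ "complex_of_real (1 / norm e) *\<^sub>C e"])
        (simp add: scaleC_in_H[OF l] norm_scaleC norm_divide)
  qed
  then show "l \<in> \<Lambda> \<Longrightarrow> unit_vector l \<in> H l" "l \<in> \<Lambda> \<Longrightarrow> norm (unit_vector l) = 1"
    unfolding unit_vector_def by (metis (mono_tags, lifting) someI_ex)+
qed

text \<open>Both \<open>D\<close> and \<open>C\<close> are linear, surjective and preserve orthogonality, hence are multiples of
  unitaries; the factors are the norms of the images of a unit vector.\<close>

lemma block_form_scaled_unitaries: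
  assumes B: "block_form l m D C"
  obtains d c D1 C1 where "d > 0" "c > 0" "d * c = norm (D (unit_vector l)) * norm (C (unit_vector l))"
    "unitary_between (H l) (H m) D1" "unitary_between (H l) (H m) C1"
    "\<And>u. u \<in> H l \<Longrightarrow> D u = complex_of_real d *\<^sub>C D1 u" "\<And>u. u \<in> H l \<Longrightarrow> C u = complex_of_real c *\<^sub>C C1 u"
proof -
  note BD = block_formD[OF B] and lin = block_form_add[OF B] block_form_scaleC[OF B] and surj = block_form_surj[OF B]
  note e = unit_vector[OF BD(1)]
  have e0: "unit_vector l \<noteq> 0"
    using e(2) by auto
  have unitary: "\<exists>t T1. t > 0 \<and> t = norm (T (unit_vector l)) \<and> unitary_between (H l) (H m) T1 \<and>
      (\<forall>u\<in>H l. T u = complex_of_real t *\<^sub>C T1 u)"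
    if T: "\<And>u v. u \<in> H l \<Longrightarrow> v \<in> H l \<Longrightarrow> T (u + v) = T u + T v"
      "\<And>c u. u \<in> H l \<Longrightarrow> T (c *\<^sub>C u) = c *\<^sub>C T u"
      "\<And>u v. u \<in> H l \<Longrightarrow> v \<in> H l \<Longrightarrow> cinner u v = 0 \<Longrightarrow> cinner (T u) (T v) = 0"
      "T ` H l = H m" "T (unit_vector l) \<noteq> 0" for T
  proof -
    obtain d where d: "d \<ge> 0" "\<And>x y. x \<in> H l \<Longrightarrow> y \<in> H l \<Longrightarrow> cinner (T x) (T y) = complex_of_real d * cinner x y"
      using orthogonality_preserving_scaled_isometry[OF csubspace_H[OF BD(1)] T(1,2,3)] by blast
    define t where "t = norm (T (unit_vector l))"
    have t: "t > 0"
      using T(5) by (simp add: t_def)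
    have "complex_of_real (t\<^sup>2) = complex_of_real d"
      using d(2)[OF e(1) e(1)] e(2) by (simp add: cinner_self t_def)
    then have dt: "d = t\<^sup>2"
      by (simp only: of_real_eq_iff)
    define T1 where "T1 u = complex_of_real (1 / t) *\<^sub>C T u" for u
    have T_eq: "T u = complex_of_real t *\<^sub>C T1 u" for u
      using t by (simp add: T1_def scaleC_scaleC scaleC_one)
    have "unitary_between (H l) (H m) T1"
    proof (rule unitary_between_if_cinner_preserving[OF csubspace_H[OF BD(1)]])
      show "cinner (T1 x) (T1 y) = cinner x y" if "x \<in> H l" "y \<in> H l" for x y
        using t by (simp add: T1_def cinner_simps d(2)[OF that] dt power2_eq_square)
      have "T1 ` H l = (\<lambda>u. T (complex_of_real (1 / t) *\<^sub>C u)) ` H l"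
        by (intro image_cong refl) (simp only: T1_def T(2))
      also have "\<dots> = T ` H l"
      proof -
        have "u \<in> (\<lambda>u. complex_of_real (1 / t) *\<^sub>C u) ` H l" if "u \<in> H l" for u
          using t scaleC_in_H[OF BD(1) that, of "complex_of_real t"]
          by (intro image_eqI[of _ _ "complex_of_real t *\<^sub>C u"]) (simp_all add: scaleC_scaleC scaleC_one)
        then have "(\<lambda>u. complex_of_real (1 / t) *\<^sub>C u) ` H l = H l"
          using scaleC_in_H[OF BD(1)] by blast
        then show ?thesis
          by (metis image_image)
      qed
      finally show "T1 ` H l = H m"
        using T(4) by simp
    qed
    then show ?thesis
      using t T_eq t_def by blast
  qed
  obtain d D1 where D1: "d > 0" "d = norm (D (unit_vector l))" "unitary_between (H l) (H m) D1"
    "\<forall>u\<in>H l. D u = complex_of_real d *\<^sub>C D1 u"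
    using unitary[of D, OF lin(1) lin(3) block_form_left_orthogonal[OF B B] surj(1)
        block_form_nonzero(1)[OF B e(1) e0]] by blast
  have right: "cinner (C u) (C v) = 0" if uv: "u \<in> H l" "v \<in> H l" "cinner u v = 0" for u v
  proof (cases "u = 0 \<or> v = 0")
    case True
    then show ?thesis
      using block_form_zero(2)[OF B] by auto
  next
    case False
    let ?n = "\<lambda>u. complex_of_real (1 / norm u) *\<^sub>C u"
    have "cinner (C (?n u)) (C (?n v)) = 0"
      using False uv scaleC_in_H[OF BD(1)]
      by (intro block_form_right_orthogonal(1)[OF B B]) (auto simp: norm_scaleC norm_divide cinner_simps)
    then show ?thesis
      using False uv by (simp add: lin cinner_simps)
  qed
  obtain c C1 where C1: "c > 0" "c = norm (C (unit_vector l))" "unitary_between (H l) (H m) C1"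
    "\<forall>u\<in>H l. C u = complex_of_real c *\<^sub>C C1 u"
    using unitary[of C, OF lin(2) lin(4) right surj(2) block_form_nonzero(2)[OF B e(1) e0]] by blast
  show ?thesis
    using that[of d c D1 C1] D1 C1 by auto
qed

text \<open>The scalars of different blocks coincide: unit vectors from two blocks are orthogonal, so
  \<open>block_form_right_orthogonal\<close> compares \<open>norm (D e) * norm (C e)\<close> in both directions.\<close>

lemma unitary_block_form:
  obtains \<alpha> \<sigma> D C where "\<alpha> > (0::real)" "bij_betw \<sigma> \<Lambda> \<Lambda>"
    "\<And>l. l \<in> \<Lambda> \<Longrightarrow> unitary_between (H l) (H (\<sigma> l)) (D l)"
    "\<And>l. l \<in> \<Lambda> \<Longrightarrow> unitary_between (H l) (H (\<sigma> l)) (C l)"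
    "\<And>l u v. l \<in> \<Lambda> \<Longrightarrow> u \<in> H l \<Longrightarrow> v \<in> H l \<Longrightarrow>
      \<Phi> (rank_one u v) = complex_of_real \<alpha> *\<^sub>C rank_one (D l u) (C l v)"
proof -
  have "\<exists>m D C. block_form l m D C" if "l \<in> \<Lambda>" for l
    using block_form_exists[OF that] by metis
  then obtain \<sigma> D0 C0 where B: "\<And>l. l \<in> \<Lambda> \<Longrightarrow> block_form l (\<sigma> l) (D0 l) (C0 l)"
    by metis
  define f where "f l = norm (D0 l (unit_vector l)) * norm (C0 l (unit_vector l))" for l
  have f_le: "f l \<le> f l'" if "l \<in> \<Lambda>" "l' \<in> \<Lambda>" for l l'
  proof (cases "l = l'")
    case False
    then have "cinner (unit_vector l') (unit_vector l) = 0"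
      using orthogonal_H that unit_vector(1) by blast
    then show ?thesis
      unfolding f_def using that unit_vector by (intro block_form_right_orthogonal(2)[OF B B]) auto
  qed simp
  have bij: "bij_betw \<sigma> \<Lambda> \<Lambda>"
    unfolding bij_betw_def
  proof
    show "inj_on \<sigma> \<Lambda>"
      by (rule inj_onI) (metis B block_form_source_unique)
    have "m \<in> \<sigma> ` \<Lambda>" if m: "m \<in> \<Lambda>" for m
    proof -
      obtain e where e: "e \<in> H m" "e \<noteq> 0"
        using nontrivial[OF m] zero_in_H[OF m] by blast
      obtain l u v where l: "l \<in> \<Lambda>" "u \<in> H l" "v \<in> H l" "\<Phi> (rank_one u v) = rank_one e e"
        using rank_one_preimage[OF m e] by blast
      have "\<sigma> l = m"
        by (rule block_form_target_unique(1)[OF B[OF l(1)] l(2,3) m e e(2) l(4)])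
      then show ?thesis
        using l by blast
    qed
    then show "\<sigma> ` \<Lambda> = \<Lambda>"
      using B block_formD(2) by blast
  qed
  have "\<exists>D1 C1. unitary_between (H l) (H (\<sigma> l)) D1 \<and> unitary_between (H l) (H (\<sigma> l)) C1 \<and> f l > 0 \<and>
      (\<forall>u\<in>H l. \<forall>v\<in>H l. \<Phi> (rank_one u v) = complex_of_real (f l) *\<^sub>C rank_one (D1 u) (C1 v))"
    if l: "l \<in> \<Lambda>" for l
  proof -
    obtain d c D1 C1 where dc: "d > 0" "c > 0" "d * c = f l"
      and un: "unitary_between (H l) (H (\<sigma> l)) D1" "unitary_between (H l) (H (\<sigma> l)) C1"
      and eq: "\<And>u. u \<in> H l \<Longrightarrow> D0 l u = complex_of_real d *\<^sub>C D1 u"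
        "\<And>u. u \<in> H l \<Longrightarrow> C0 l u = complex_of_real c *\<^sub>C C1 u"
      unfolding f_def using block_form_scaled_unitaries[OF B[OF l]] by metis
    have "\<Phi> (rank_one u v) = complex_of_real (f l) *\<^sub>C rank_one (D1 u) (C1 v)" if "u \<in> H l" "v \<in> H l" for u v
      using block_formD(5)[OF B[OF l] that] that dc(3)[symmetric]
      by (simp add: eq rank_one_scaleC_left rank_one_scaleC_right scaleC_scaleC mult.commute)
    moreover have "f l > 0"
      using dc by (metis mult_pos_pos)
    ultimately show ?thesis
      using un by blast
  qed
  then obtain D C where DC: "\<And>l. l \<in> \<Lambda> \<Longrightarrow> unitary_between (H l) (H (\<sigma> l)) (D l) \<and>
      unitary_between (H l) (H (\<sigma> l)) (C l) \<and> f l > 0 \<and>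
      (\<forall>u\<in>H l. \<forall>v\<in>H l. \<Phi> (rank_one u v) = complex_of_real (f l) *\<^sub>C rank_one (D l u) (C l v))"
    by metis
  obtain \<alpha> where \<alpha>: "\<alpha> > 0" "\<And>l. l \<in> \<Lambda> \<Longrightarrow> f l = \<alpha>"
  proof (cases "\<Lambda> = {}")
    case True
    then show ?thesis
      using that[of 1] by simp
  next
    case False
    then obtain l where "l \<in> \<Lambda>"
      by blast
    then show ?thesis
      using that[of "f l"] DC f_le by (meson order_antisym)
  qed
  show ?thesis
    using that[OF \<alpha>(1) bij, of D C] DC \<alpha>(2) by auto
qed

text \<open>It suffices to test both sides against \<open>D \<xi>\<close>. The rank-one operator \<open>F = \<xi> \<otimes> w\<^sup>*\<close>, with \<open>w\<close>
  the multiple of \<open>X\<^sup>* \<xi>\<close> for which \<open>(X - F)\<^sup>* \<xi> = 0\<close>, makes \<open>\<xi> \<otimes> \<xi>\<^sup>*\<close> strongly orthogonal to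
  \<open>X - F\<close>. Applying \<open>\<Phi>\<close> shows that \<open>D \<xi>\<close> is orthogonal to the range of \<open>\<Phi> X - \<Phi> F\<close> on the target
  block, where \<open>\<Phi> F\<close> is known.\<close>

lemma image_apply:
  assumes l: "l \<in> \<Lambda>" and m: "m \<in> \<Lambda>"
    and D: "unitary_between (H l) (H m) D" and C: "unitary_between (H l) (H m) C"
    and \<Phi>: "\<And>u v. u \<in> H l \<Longrightarrow> v \<in> H l \<Longrightarrow> \<Phi> (rank_one u v) = \<alpha> *\<^sub>C rank_one (D u) (C v)"
    and \<alpha>: "\<alpha> \<noteq> 0" and X: "X \<in> \<AA>" and x: "x \<in> H l"
  shows "blinfun_apply (\<Phi> X) (C x) = \<alpha> *\<^sub>C D (blinfun_apply X x)"
proof -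
  note X' = compact_sum_block_diagonal[OF X]
  have DH: "D u \<in> H m" and CH: "C u \<in> H m" if "u \<in> H l" for u
    using D C that by (auto simp: unitary_between_def)
  have Dc: "cinner (D u) (D v) = cinner u v" and Cc: "cinner (C u) (C v) = cinner u v"
    if "u \<in> H l" "v \<in> H l" for u v
    using D C that by (auto simp: unitary_between_def)
  have Xx: "blinfun_apply X x \<in> H l"
    using l x by (rule block_diagonal_in_H[OF X'])
  have test: "cinner (blinfun_apply (\<Phi> X) (C x)) (D \<xi>) = \<alpha> * cinner (blinfun_apply X x) \<xi>"
    if \<xi>: "\<xi> \<in> H l" "\<xi> \<noteq> 0" for \<xi>
  proof -
    obtain v where v: "v \<in> H l" "\<And>y. cinner (blinfun_apply X y) \<xi> = cinner y v"
      using block_adjoint_exists[OF X' l \<xi>(1)] by blast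
    define w where "w = cnj (1 / cinner \<xi> \<xi>) *\<^sub>C v"
    have w: "w \<in> H l" "\<And>y. cinner y w * cinner \<xi> \<xi> = cinner (blinfun_apply X y) \<xi>"
      using scaleC_in_H[OF l v(1)] \<xi>(2) by (simp_all add: w_def cinner_scaleC_right v(2))
    define F where "F = rank_one \<xi> w"
    have F: "F \<in> \<AA>" "\<Phi> F = \<alpha> *\<^sub>C rank_one (D \<xi>) (C w)"
      unfolding F_def using \<Phi> rank_one_in_compact_sum[OF l] \<xi> w by auto
    have D0: "D \<xi> \<noteq> 0" and C0: "\<alpha> *\<^sub>C D \<xi> \<noteq> 0" "C \<xi> \<noteq> 0"
      using \<xi> \<alpha> Dc[OF \<xi>(1) \<xi>(1)] Cc[OF \<xi>(1) \<xi>(1)] by auto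
    have mem: "rank_one \<xi> \<xi> \<in> \<AA>" "X - F \<in> \<AA>"
      using rank_one_in_compact_sum[OF l] \<xi> compact_sum_diff[OF X F(1)] by auto
    have image_mem: "\<Phi> (X - F) \<in> \<AA>"
      using bij mem(2) by (auto simp: bij_betw_def)
    have "strong_BJ \<AA> (rank_one \<xi> \<xi>) (X - F)"
      unfolding strong_BJ_rank_one_iff[OF l \<xi> \<xi> mem(2)]
      by (simp add: blinfun.diff_left cinner_diff_left F_def cinner_scaleC_left w)
    then have "strong_BJ \<AA> (rank_one (\<alpha> *\<^sub>C D \<xi>) (C \<xi>)) (\<Phi> (X - F))"
      using strong_BJ_iff[OF mem] \<Phi>[OF \<xi>(1) \<xi>(1)] by (simp add: rank_one_scaleC_left)
    then have "cinner (blinfun_apply (\<Phi> (X - F)) (C x)) (\<alpha> *\<^sub>C D \<xi>) = 0"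
      using strong_BJ_rank_one_iff[OF m scaleC_in_H[OF m DH[OF \<xi>(1)]] C0(1) CH[OF \<xi>(1)] C0(2) image_mem]
        CH[OF x] by blast
    then have "cinner (blinfun_apply (\<Phi> X) (C x)) (D \<xi>) = cinner (blinfun_apply (\<Phi> F) (C x)) (D \<xi>)"
      using \<alpha> by (simp add: diff[OF X F(1)] blinfun.diff_left cinner_diff_left cinner_scaleC_right)
    also have "\<dots> = \<alpha> * (cinner x w * cinner \<xi> \<xi>)"
      by (simp add: F(2) cinner_scaleC_left Cc[OF x w(1)] Dc[OF \<xi>(1) \<xi>(1)])
    finally show ?thesis
      by (simp add: w(2))
  qed
  define b where "b = blinfun_apply (\<Phi> X) (C x) - \<alpha> *\<^sub>C D (blinfun_apply X x)"
  have "b \<in> H m"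
    unfolding b_def
    by (intro diff_in_H scaleC_in_H m DH Xx block_diagonal_in_H[OF compact_sum_block_diagonal[OF mem[OF X]]] CH x)
  then have "b \<in> D ` H l"
    using D by (simp add: unitary_between_def)
  then obtain \<xi> where \<xi>: "\<xi> \<in> H l" "b = D \<xi>"
    by blast
  have "cinner b (D \<xi>) = 0"
  proof (cases "\<xi> = 0")
    case True
    then show ?thesis
      using Dc[OF \<xi>(1) \<xi>(1)] by simp
  next
    case False
    then show ?thesis
      by (simp add: b_def cinner_diff_left cinner_scaleC_left test[OF \<xi>(1)] Dc[OF Xx \<xi>(1)])
  qed
  then show ?thesis
    using \<xi>(2) by (simp add: b_def)
qed

end

section \<open>Assembling the two factors\<close>

lemma cadjoint_eqI:
  assumes "\<And>x y. cinner (blinfun_apply A x) y = cinner x (blinfun_apply B y)"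
  shows "cadjoint A = B"
  unfolding cadjoint_def
proof (rule the_equality)
  fix B' assume B': "\<forall>x y. cinner (blinfun_apply A x) y = cinner x (blinfun_apply B' y)"
  show "B' = B"
  proof (rule blinfun_eqI)
    fix y
    let ?d = "blinfun_apply B' y - blinfun_apply B y"
    have "cinner ?d ?d = 0"
      using assms[of ?d y] B' by (simp add: cinner_diff_right)
    then show "blinfun_apply B' y = blinfun_apply B y"
      by simp
  qed
qed (use assms in blast)

context hilbert_decomposition
begin

lemma isometry_from_blocks:
  assumes G: "\<And>l. l \<in> \<Lambda> \<Longrightarrow> unitary_between (H l) (H l) (G l)"
  obtains U where "U \<in> bounded_ops" "\<And>l x. l \<in> \<Lambda> \<Longrightarrow> x \<in> H l \<Longrightarrow> blinfun_apply U x = G l x"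
    "\<And>x y. cinner (blinfun_apply U x) (blinfun_apply U y) = cinner x y"
proof -
  note extension = that
  have G': "\<And>x y. x \<in> H l \<Longrightarrow> y \<in> H l \<Longrightarrow> cinner (G l x) (G l y) = cinner x y"
    "\<And>x. x \<in> H l \<Longrightarrow> G l x \<in> H l" if "l \<in> \<Lambda>" for l
    using G[OF that] by (auto simp: unitary_between_def)
  \<comment> \<open>Only \<open>0\<close> lies in several blocks, and all \<open>G l\<close> agree there.\<close>
  define f where "f x = G (SOME l. l \<in> \<Lambda> \<and> x \<in> H l) x" for x
  have f: "f x = G l x" if "l \<in> \<Lambda>" "x \<in> H l" for l x
  proof -
    define k where "k = (SOME l. l \<in> \<Lambda> \<and> x \<in> H l)"
    have k: "k \<in> \<Lambda>" "x \<in> H k"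
      unfolding k_def using someI[of "\<lambda>l. l \<in> \<Lambda> \<and> x \<in> H l" l] that by blast+
    show ?thesis
    proof (cases "x = 0")
      case True
      then have "G l x = 0" "G k x = 0"
        using G'(1)[OF that(1) that(2) that(2)] G'(1)[OF k(1) k(2) k(2)] by simp_all
      then show ?thesis
        by (simp add: f_def k_def)
    next
      case False
      then have "k = l"
        using block_unique k that by blast
      then show ?thesis
        by (simp add: f_def k_def)
    qed
  qed
  have preserve: "cinner (f x) (f y) = cinner x y" if xy: "x \<in> (\<Union>l\<in>\<Lambda>. H l)" "y \<in> (\<Union>l\<in>\<Lambda>. H l)" for x y
  proof -
    obtain l m where lm: "l \<in> \<Lambda>" "x \<in> H l" "m \<in> \<Lambda>" "y \<in> H m"
      using xy by blast
    show ?thesis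
    proof (cases "l = m")
      case True
      then show ?thesis
        using lm by (simp add: f G')
    next
      case False
      then show ?thesis
        using orthogonal_H[OF lm(1,3) False] lm by (simp add: f G')
    qed
  qed
  show ?thesis
  proof (rule isometric_extension[of "\<Union>l\<in>\<Lambda>. H l" f])
    show "c *\<^sub>C x \<in> (\<Union>l\<in>\<Lambda>. H l)" if "x \<in> (\<Union>l\<in>\<Lambda>. H l)" for c x
      using that scaleC_in_H by blast
    show "x = 0" if "\<And>s. s \<in> (\<Union>l\<in>\<Lambda>. H l) \<Longrightarrow> cinner x s = 0" for x
      using that by (intro eq_0_if_orthogonal_to_blocks) blast
    show thesis
      if "U \<in> bounded_ops" "\<And>x. x \<in> (\<Union>l\<in>\<Lambda>. H l) \<Longrightarrow> blinfun_apply U x = f x"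
        "\<And>x y. cinner (blinfun_apply U x) (blinfun_apply U y) = cinner x y" for U
      by (rule extension[OF that(1) _ that(3)]) (metis UN_I f that(2))
  qed (rule preserve)
qed

lemma block_unitary_if_inverse_isometries:
  assumes U: "U \<in> bounded_ops" "\<And>x y. cinner (blinfun_apply U x) (blinfun_apply U y) = cinner x y"
    and UV: "U o\<^sub>L V = id_blinfun" "V o\<^sub>L U = id_blinfun"
    and G: "\<And>l. l \<in> \<Lambda> \<Longrightarrow> unitary_between (H l) (H l) (G l)"
    and U_eq: "\<And>l x. l \<in> \<Lambda> \<Longrightarrow> x \<in> H l \<Longrightarrow> blinfun_apply U x = G l x"
  shows "block_unitary \<Lambda> H U"
  unfolding block_unitary_def
proof (intro conjI ballI)
  have UV_apply: "blinfun_apply U (blinfun_apply V x) = x" for x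
    using arg_cong[OF UV(1), of "\<lambda>A. blinfun_apply A x"] by simp
  have "cadjoint U = V"
    by (rule cadjoint_eqI) (metis U(2) UV_apply)
  then show "unitary_op U"
    unfolding unitary_op_def using U(1) UV by simp
  show block: "unitary_between (H l) (H l) (blinfun_apply U)" if "l \<in> \<Lambda>" for l
  proof (rule unitary_between_if_cinner_preserving[OF csubspace_H[OF that] U(2)])
    have "blinfun_apply U ` H l = G l ` H l"
      by (intro image_cong refl U_eq that)
    then show "blinfun_apply U ` H l = H l"
      using G[OF that] by (simp add: unitary_between_def)
  qed
  then show "block_diagonal \<Lambda> H U"
    unfolding block_diagonal_def using U(1) by (simp add: unitary_between_def)
qed

lemma block_unitary_from_blocks:
  assumes G: "\<And>l. l \<in> \<Lambda> \<Longrightarrow> unitary_between (H l) (H l) (G l)"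
  obtains U V where "block_unitary \<Lambda> H U" "block_unitary \<Lambda> H V"
    "U o\<^sub>L V = id_blinfun" "V o\<^sub>L U = id_blinfun"
    "\<And>l x. l \<in> \<Lambda> \<Longrightarrow> x \<in> H l \<Longrightarrow> blinfun_apply U x = G l x"
proof -
  let ?G' = "\<lambda>l. inv_into (H l) (G l)"
  have G': "unitary_between (H l) (H l) (?G' l)" if "l \<in> \<Lambda>" for l
    using csubspace_H G that by (blast intro: unitary_between_inv_into)
  obtain U where U: "U \<in> bounded_ops" "\<And>l x. l \<in> \<Lambda> \<Longrightarrow> x \<in> H l \<Longrightarrow> blinfun_apply U x = G l x"
    "\<And>x y. cinner (blinfun_apply U x) (blinfun_apply U y) = cinner x y"
    using isometry_from_blocks[of G, OF G] by blast
  obtain V where V: "V \<in> bounded_ops" "\<And>l x. l \<in> \<Lambda> \<Longrightarrow> x \<in> H l \<Longrightarrow> blinfun_apply V x = ?G' l x"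
    "\<And>x y. cinner (blinfun_apply V x) (blinfun_apply V y) = cinner x y"
    using isometry_from_blocks[of ?G', OF G'] by blast
  have inv: "G l (?G' l x) = x" "?G' l (G l x) = x" "?G' l x \<in> H l" "G l x \<in> H l" if "l \<in> \<Lambda>" "x \<in> H l" for l x
    using G[OF that(1)] G'[OF that(1)] that unitary_between_inj_on[OF csubspace_H[OF that(1)] G[OF that(1)]]
    by (auto simp: unitary_between_def f_inv_into_f)
  have bop: "id_blinfun \<in> bounded_ops" "U o\<^sub>L V \<in> bounded_ops" "V o\<^sub>L U \<in> bounded_ops"
    using U(1) V(1) by (auto simp: mem_bounded_ops_iff)
  have "U o\<^sub>L V = id_blinfun"
    by (rule bounded_ops_eqI[OF bop(2,1)]) (simp add: U(2) V(2) inv)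
  moreover have "V o\<^sub>L U = id_blinfun"
    by (rule bounded_ops_eqI[OF bop(3,1)]) (simp add: U(2) V(2) inv)
  ultimately show ?thesis
    using that block_unitary_if_inverse_isometries[OF U(1,3) _ _ G U(2)]
      block_unitary_if_inverse_isometries[OF V(1,3) _ _ G' V(2)] U(2) by blast
qed

lemma block_unitary_id: "block_unitary \<Lambda> H id_blinfun"
  by (rule block_unitary_if_inverse_isometries[of _ id_blinfun "\<lambda>_ x. x"])
    (auto simp: mem_bounded_ops_iff unitary_between_def intro: blinfun_eqI)

end

text \<open>From \<open>\<Phi> X = \<alpha> D X C\<^sup>*\<close> on blocks, the factors are found by writing \<open>D = C (C\<^sup>* D)\<close>: the permutation
  of blocks conjugates by \<open>C\<close>, and the multiplication has left factor \<open>U\<close> with blocks \<open>C\<^sup>* D\<close> and right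
  factor the identity. Taking \<open>\<Phi>\<^sub>1\<close> to be \<open>A \<mapsto> \<Phi> (U\<^sup>* A) / \<alpha>\<close> makes the factorization immediate and
  keeps \<open>\<Phi>\<^sub>1\<close> inside the algebra.\<close>

lemma (in linear_strong_BJ_isomorphism) decomposition_into_factors:
  "\<exists>\<alpha> \<Phi>\<^sub>1 \<Phi>\<^sub>2. \<alpha> \<noteq> 0 \<and> block_permutation \<Lambda> H \<Phi>\<^sub>1 \<and> unitary_multiplication \<Lambda> H \<Phi>\<^sub>2 \<and>
    (\<forall>X\<in>\<AA>. (1 / \<alpha>) *\<^sub>C \<Phi> X = (\<Phi>\<^sub>1 \<circ> \<Phi>\<^sub>2) X)"
proof -
  obtain \<alpha> \<sigma> D C where \<alpha>: "\<alpha> > (0::real)" and \<sigma>: "bij_betw \<sigma> \<Lambda> \<Lambda>"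
    and D: "\<And>l. l \<in> \<Lambda> \<Longrightarrow> unitary_between (H l) (H (\<sigma> l)) (D l)"
    and C: "\<And>l. l \<in> \<Lambda> \<Longrightarrow> unitary_between (H l) (H (\<sigma> l)) (C l)"
    and \<Phi>: "\<And>l u v. l \<in> \<Lambda> \<Longrightarrow> u \<in> H l \<Longrightarrow> v \<in> H l \<Longrightarrow>
      \<Phi> (rank_one u v) = complex_of_real \<alpha> *\<^sub>C rank_one (D l u) (C l v)"
    using unitary_block_form by blast
  define \<phi> where "\<phi> = inv_into \<Lambda> \<sigma>"
  have \<phi>: "bij_betw \<phi> \<Lambda> \<Lambda>" "\<And>l. l \<in> \<Lambda> \<Longrightarrow> \<phi> l \<in> \<Lambda>" "\<And>l. l \<in> \<Lambda> \<Longrightarrow> \<sigma> (\<phi> l) = l"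
    "\<And>l. l \<in> \<Lambda> \<Longrightarrow> \<sigma> l \<in> \<Lambda>"
    using \<sigma> bij_betw_inv_into[OF \<sigma>] by (auto simp: \<phi>_def bij_betw_def f_inv_into_f)
  define G where "G l = inv_into (H l) (C l) \<circ> D l" for l
  have G: "unitary_between (H l) (H l) (G l)" if "l \<in> \<Lambda>" for l
    unfolding G_def using that \<phi>(4) csubspace_H D C
    by (blast intro: unitary_between_comp unitary_between_inv_into)
  obtain U V where U: "block_unitary \<Lambda> H U" and V: "block_unitary \<Lambda> H V"
    and UV: "U o\<^sub>L V = id_blinfun" "V o\<^sub>L U = id_blinfun"
    and U_eq: "\<And>l x. l \<in> \<Lambda> \<Longrightarrow> x \<in> H l \<Longrightarrow> blinfun_apply U x = G l x"
    using block_unitary_from_blocks[of G, OF G] by blast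
  have V_block: "block_diagonal \<Lambda> H V"
    using V by (simp add: block_unitary_def)
  define \<Phi>\<^sub>1 where "\<Phi>\<^sub>1 A = (1 / complex_of_real \<alpha>) *\<^sub>C \<Phi> (V o\<^sub>L A)" for A
  define \<Phi>\<^sub>2 where "\<Phi>\<^sub>2 X = U o\<^sub>L X" for X :: "'h \<Rightarrow>\<^sub>L 'h"
  have CV: "D l (blinfun_apply V x) = C l x" if l: "l \<in> \<Lambda>" and x: "x \<in> H l" for l x
  proof -
    have Vx: "blinfun_apply V x \<in> H l"
      using V_block l x by (rule block_diagonal_in_H)
    then have DVx: "D l (blinfun_apply V x) \<in> C l ` H l"
      using C[OF l] D[OF l] by (auto simp: unitary_between_def)
    have "inv_into (H l) (C l) (D l (blinfun_apply V x)) = blinfun_apply (U o\<^sub>L V) x"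
      using U_eq[OF l Vx] by (simp add: G_def)
    then have "inv_into (H l) (C l) (D l (blinfun_apply V x)) = x"
      by (simp add: UV)
    then show ?thesis
      using f_inv_into_f[OF DVx] by simp
  qed
  have "block_permutation \<Lambda> H \<Phi>\<^sub>1"
    unfolding block_permutation_def
  proof (intro exI conjI ballI)
    show "bij_betw \<phi> \<Lambda> \<Lambda>"
      by (rule \<phi>(1))
    show W: "unitary_between (H (\<phi> l)) (H l) (C (\<phi> l))" if "l \<in> \<Lambda>" for l
      using C[OF \<phi>(2)[OF that]] \<phi>(3)[OF that] by simp
    show "same_dim (H (\<phi> l)) (H l)" if "l \<in> \<Lambda>" for l
      using csubspace_H closed_H \<phi>(2) W that by (intro same_dim_if_unitary_between) auto
    fix A assume A: "A \<in> \<AA>"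
    have VA: "V o\<^sub>L A \<in> \<AA>"
      by (rule compact_sum_comp[OF V_block A])
    show "\<Phi>\<^sub>1 A \<in> \<AA>"
      unfolding \<Phi>\<^sub>1_def by (intro compact_sum_scaleC mem VA)
    fix l x assume l: "l \<in> \<Lambda>" and x: "x \<in> H l"
    define y where "y = inv_into (H (\<phi> l)) (C (\<phi> l)) x"
    have "x \<in> C (\<phi> l) ` H (\<phi> l)"
      using W[OF l] x by (simp add: unitary_between_def)
    then have y: "y \<in> H (\<phi> l)" "C (\<phi> l) y = x"
      unfolding y_def by (simp_all add: inv_into_into f_inv_into_f)
    have "blinfun_apply (\<Phi> (V o\<^sub>L A)) (C (\<phi> l) y)
        = complex_of_real \<alpha> *\<^sub>C D (\<phi> l) (blinfun_apply (V o\<^sub>L A) y)"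
      using \<phi>(2)[OF l] \<phi>(4) D C \<Phi> \<alpha> VA y(1) by (intro image_apply[of "\<phi> l" "\<sigma> (\<phi> l)"]) auto
    also have "\<dots> = complex_of_real \<alpha> *\<^sub>C C (\<phi> l) (blinfun_apply A y)"
      using CV[OF \<phi>(2)[OF l] block_diagonal_in_H[OF compact_sum_block_diagonal[OF A] \<phi>(2)[OF l] y(1)]] by simp
    finally show "blinfun_apply (\<Phi>\<^sub>1 A) x = C (\<phi> l) (blinfun_apply A (inv_into (H (\<phi> l)) (C (\<phi> l)) x))"
      using \<alpha> y(2) by (simp add: \<Phi>\<^sub>1_def scaleC_scaleC scaleC_one flip: y_def)
  qed
  moreover have "unitary_multiplication \<Lambda> H \<Phi>\<^sub>2"
  proof -
    have "cadjoint id_blinfun = (id_blinfun :: 'h \<Rightarrow>\<^sub>L 'h)"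
      by (rule cadjoint_eqI) simp
    then have "\<Phi>\<^sub>2 X = U o\<^sub>L X o\<^sub>L cadjoint id_blinfun" for X
      by (simp add: \<Phi>\<^sub>2_def blinfun_eqI)
    then show ?thesis
      unfolding unitary_multiplication_def using U block_unitary_id by blast
  qed
  moreover have "(1 / complex_of_real \<alpha>) *\<^sub>C \<Phi> X = (\<Phi>\<^sub>1 \<circ> \<Phi>\<^sub>2) X" for X
  proof -
    have "V o\<^sub>L (U o\<^sub>L X) = X"
      using arg_cong[OF UV(2), of "\<lambda>A. blinfun_apply A (blinfun_apply X _)"]
      by (intro blinfun_eqI) simp
    then show ?thesis
      by (simp add: \<Phi>\<^sub>1_def \<Phi>\<^sub>2_def)
  qed
  moreover have "complex_of_real \<alpha> \<noteq> 0"
    using \<alpha> by simp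
  ultimately show ?thesis
    by blast
qed

theorem theorem4p5:
  fixes \<Lambda> :: "'l set"
    and H :: "'l \<Rightarrow> 'h::chilbert_space set"
    and \<Phi> :: "('h \<Rightarrow>\<^sub>L 'h) \<Rightarrow> ('h \<Rightarrow>\<^sub>L 'h)"
  assumes "hilbert_direct_sum \<Lambda> H"
    and "\<forall>l\<in>\<Lambda>. H l \<noteq> {0}"
    and "complex_linear_on (compact_sum \<Lambda> H) \<Phi>"
    and "strong_BJ_isomorphism (compact_sum \<Lambda> H) \<Phi>"
  shows "\<exists>\<alpha> \<Phi>\<^sub>1 \<Phi>\<^sub>2. \<alpha> \<noteq> 0 \<and>
    block_permutation \<Lambda> H \<Phi>\<^sub>1 \<and>
    unitary_multiplication \<Lambda> H \<Phi>\<^sub>2 \<and>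
    (\<forall>X\<in>compact_sum \<Lambda> H. (1 / \<alpha>) *\<^sub>C \<Phi> X = (\<Phi>\<^sub>1 \<circ> \<Phi>\<^sub>2) X)"
proof -
  interpret linear_strong_BJ_isomorphism \<Lambda> H \<Phi>
    using assms by unfold_locales auto
  show ?thesis
    by (rule decomposition_into_factors)
qed

end
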